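(* Let $(f_\Sigma,f_\Gamma)\in H^{1/2}(\Sigma)\times H^{1/2}(\Gamma)$ be a solution of the interface system $$f_\Sigma-\mathrm{K}_{\Sigma\Gamma}f_\Gamma=\gamma_\Sigma u^{\rm inc},\qquad -\mathrm{K}_{\Gamma\Sigma}f_\Sigma+f_\Gamma=-\gamma_\Gamma u^{\rm inc}.$$ Then $\mathrm{K}_{\Omega_{12}\Sigma}f_\Sigma=u^{\rm inc}|_{\Omega_{12}}+\mathrm{K}_{\Omega_{12}\Gamma}f_\Gamma$ in $\Omega_{12}$, so that the function $$u:=\begin{cases}\mathrm{K}_{\Omega_2\Sigma}f_\Sigma & \text{in }\Omega_2,\\ \mathrm{K}_{\Omega_1^{\rm c}\Gamma}f_\Gamma+u^{\rm inc} & \text{in }\Omega_1^{\rm c}\end{cases}$$ is well defined on $\mathbb{R}^m$, and $u$ is the solution in $H^1_{\rm loc}(\mathbb{R}^m)$ of the full-space problem $$\Delta u+k^2n^2u=0\ \text{ in }\mathbb{R}^m,\qquad \partial_r u^s-\mathrm{i}k u^s=o\big(r^{-(m-1)/2}\big)\ \text{ as } r=|\mathbf{x}|\to\infty,\qquad u^s:=u-u^{\rm inc}.$$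
   Context: Setting. $m\in\{2,3\}$, $k>0$. $\Omega_0\subset\mathbb{R}^m$ is a bounded domain (region). $n$ is a real-valued, piecewise smooth refractive index function on $\mathbb{R}^m$ with $1-n$ supported in the compact set $\overline{\Omega}_0$ (so $n\equiv1$ outside $\overline\Omega_0$). $\Gamma$ and $\Sigma$ are closed curves ($m=2$) or surfaces ($m=3$) with interiors $\Omega_1$ and $\Omega_2$ respectively, bounded Lipschitz domains such that $\overline{\Omega}_0\subset\Omega_1\subset\overline{\Omega}_1\subset\Omega_2$; $\Gamma=\partial\Omega_1$ is smooth and $\Sigma=\partial\Omega_2$ is polygonal/polyhedral. $\Omega_i^{\rm c}:=\mathbb{R}^m\setminus\overline\Omega_i$ (connected for $i=1,2$), $\Omega_{12}:=\Omega_1^{\rm c}\cap\Omega_2$. $\gamma_\Gamma,\gamma_\Sigma$ are the trace operators on $\Gamma,\Sigma$. $u^{\rm inc}$ is an incident wave (for example a plane wave of wavenumber $k$), i.e. a smooth solution of $\Delta u^{\rm inc}+k^2u^{\rm inc}=0$ in $\mathbb{R}^m$. Known fact: for each such $u^{\rm inc}$ the full-space problem in the claim has a unique solution in $H^1_{\rm loc}(\mathbb{R}^m)$. Interior problem: for $f\in H^{1/2}(\Sigma)$ find $w\in H^1(\Omega_2)$ with $\Delta w+k^2n^2w=0$ in $\Omega_2$, $\gamma_\Sigma w=f$. Standing assumption: this problem is uniquely solvable. For a Lipschitz domain or $(m-1)$-dimensional Lipschitz manifold $D\subset\Omega_2$ (also $D=\Omega_2$), $\mathrm{K}_{D\Sigma}f:=w|_D$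 (restriction or trace). In particular $\mathrm{K}_{\Gamma\Sigma}f=\gamma_\Gamma w$. Exterior problem: for $f\in H^{1/2}(\Gamma)$ let $\widetilde\omega\in H^1_{\rm loc}(\Omega_1^{\rm c})$ (i.e. $H^1$ on the intersection of $\Omega_1^{\rm c}$ with every ball) be the unique solution of $\Delta\widetilde\omega+k^2\widetilde\omega=0$ in $\Omega_1^{\rm c}$, $\gamma_\Gamma\widetilde\omega=f$, $\partial_r\widetilde\omega-\mathrm{i}k\widetilde\omega=o(r^{-(m-1)/2})$ as $r=|\mathbf{x}|\to\infty$ (this problem is always uniquely solvable). $\mathrm{K}_{D\Gamma}f:=\widetilde\omega|_D$ (restriction or trace); in particular $\mathrm{K}_{\Sigma\Gamma}f=\gamma_\Sigma\widetilde\omega$. Standing assumption: the only solution $v\in H^1(\Omega_{12})$ of $\Delta v+k^2v=0$ in $\Omega_{12}$, $\gamma_\Gamma v=0$, $\gamma_\Sigma v=0$ is $v=0$. *)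

theory Defs
  imports "HOL-Analysis.Analysis" "HOL-Library.Landau_Symbols"
begin

text \<open>
  Elements of \<open>L\<^sup>2\<close>, \<open>H\<^sup>1\<close> and \<open>H\<^sup>1\<^sup>/\<^sup>2\<close> are represented by functions; two functions denote the same
  element iff they agree almost everywhere with respect to the measure of the domain or surface.
\<close>

section \<open>Smooth functions\<close>

definition partial :: "'m \<Rightarrow> (real ^ 'm \<Rightarrow> 'b::real_normed_vector) \<Rightarrow> real ^ 'm \<Rightarrow> 'b" where
  "partial i f = (\<lambda>x. frechet_derivative f (at x) (axis i 1))"

text \<open>To be used for open \<open>U\<close>. All iterated partial derivatives are required to be differentiable,
  hence continuous, so this is \<open>C\<^sup>\<infinity>(U)\<close>.\<close>

definition smooth_on :: "(real ^ 'm) set \<Rightarrow> (real ^ 'm \<Rightarrow> 'b::real_normed_vector) \<Rightarrow> bool" where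
  "smooth_on U f \<longleftrightarrow> (\<forall>is. \<forall>x\<in>U. (foldr partial is f) differentiable (at x))"

definition laplacian :: "(real ^ 'm \<Rightarrow> 'b::real_normed_vector) \<Rightarrow> real ^ 'm \<Rightarrow> 'b" where
  "laplacian f x = (\<Sum>i\<in>UNIV. partial i (partial i f) x)"

definition radial_deriv :: "(real ^ 'm \<Rightarrow> 'b::real_normed_vector) \<Rightarrow> real ^ 'm \<Rightarrow> 'b" where
  "radial_deriv f x = frechet_derivative f (at x) (x /\<^sub>R norm x)"

definition test_functions :: "(real ^ 'm) set \<Rightarrow> (real ^ 'm \<Rightarrow> complex) set" where
  "test_functions U =
     {\<phi>. smooth_on UNIV \<phi> \<and> compact (closure {x. \<phi> x \<noteq> 0}) \<and> closure {x. \<phi> x \<noteq> 0} \<subseteq> U}"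


section \<open>Sobolev spaces on open sets\<close>

definition L2 :: "'a measure \<Rightarrow> ('a \<Rightarrow> complex) set" where
  "L2 M = {u \<in> borel_measurable M. integrable M (\<lambda>x. (cmod (u x))\<^sup>2)}"

definition L2_tendsto :: "'a measure \<Rightarrow> (nat \<Rightarrow> 'a \<Rightarrow> complex) \<Rightarrow> ('a \<Rightarrow> complex) \<Rightarrow> bool" where
  "L2_tendsto M \<phi> u \<longleftrightarrow> (\<lambda>j. \<integral>\<^sup>+x. ennreal ((cmod (\<phi> j x - u x))\<^sup>2) \<partial>M) \<longlonglongrightarrow> 0"

definition weak_partial ::
    "(real ^ 'm) set \<Rightarrow> 'm \<Rightarrow> (real ^ 'm \<Rightarrow> complex) \<Rightarrow> (real ^ 'm \<Rightarrow> complex) \<Rightarrow> bool" where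
  "weak_partial U i u g \<longleftrightarrow> (\<forall>\<phi>\<in>test_functions U.
     (\<integral>x. u x * partial i \<phi> x \<partial>lebesgue_on U) = - (\<integral>x. g x * \<phi> x \<partial>lebesgue_on U))"

definition H1 :: "(real ^ 'm) set \<Rightarrow> (real ^ 'm \<Rightarrow> complex) set" where
  "H1 U = {u \<in> L2 (lebesgue_on U). \<forall>i. \<exists>g\<in>L2 (lebesgue_on U). weak_partial U i u g}"

definition H1_loc :: "(real ^ 'm) set \<Rightarrow> (real ^ 'm \<Rightarrow> complex) set" where
  "H1_loc U = {u. \<forall>c R. u \<in> H1 (U \<inter> ball c R)}"

text \<open>Convergence in \<open>H\<^sup>1(U)\<close> of a sequence of smooth functions.\<close>

definition H1_tendsto ::
    "(real ^ 'm) set \<Rightarrow> (nat \<Rightarrow> real ^ 'm \<Rightarrow> complex) \<Rightarrow> (real ^ 'm \<Rightarrow> complex) \<Rightarrow> bool" where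
  "H1_tendsto U \<phi> u \<longleftrightarrow>
     u \<in> L2 (lebesgue_on U) \<and> L2_tendsto (lebesgue_on U) \<phi> u \<and>
     (\<forall>i. \<exists>g\<in>L2 (lebesgue_on U). weak_partial U i u g \<and>
            L2_tendsto (lebesgue_on U) (\<lambda>j. partial i (\<phi> j)) g)"


section \<open>Surface measure, boundary Sobolev spaces and traces\<close>

text \<open>\<open>d\<close>-dimensional Hausdorff measure (for \<open>d \<ge> 1\<close>), normalised so that it is the usual
  \<open>d\<close>-dimensional surface measure.\<close>

definition hausdorff_pre :: "nat \<Rightarrow> real \<Rightarrow> 'a::metric_space set \<Rightarrow> ennreal" where
  "hausdorff_pre d \<delta> A =
     (INF C \<in> {C :: nat \<Rightarrow> 'a set. A \<subseteq> (\<Union>i. C i) \<and> (\<forall>i. bounded (C i) \<and> diameter (C i) \<le> \<delta>)}.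
        (\<Sum>i. ennreal (unit_ball_vol (real d) * (diameter (C i) / 2) ^ d)))"

definition hausdorff_measure :: "nat \<Rightarrow> 'a::metric_space measure" where
  "hausdorff_measure d =
     measure_of UNIV (sets borel) (\<lambda>A. SUP \<delta>\<in>{0<..}. hausdorff_pre d \<delta> A)"

definition surface_measure :: "(real ^ 'm) set \<Rightarrow> (real ^ 'm) measure" where
  "surface_measure S = completion (restrict_space (hausdorff_measure (CARD('m) - 1)) S)"

text \<open>The Sobolev--Slobodeckij space of order 1/2 on an \<open>(m-1)\<close>-dimensional Lipschitz manifold:
  the exponent of the kernel is \<open>(m-1) + 2 \<cdot> 1/2 = m\<close>.\<close>

definition H_half :: "(real ^ 'm) set \<Rightarrow> (real ^ 'm \<Rightarrow> complex) set" where
  "H_half S = {f \<in> L2 (surface_measure S).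
     (\<integral>\<^sup>+x. (\<integral>\<^sup>+y. ennreal ((cmod (f x - f y))\<^sup>2 / dist x y ^ CARD('m)) \<partial>surface_measure S)
        \<partial>surface_measure S) < \<infinity>}"

text \<open>\<open>has_trace U S u f\<close>: the trace of \<open>u\<close> on \<open>S \<subseteq> closure U\<close> is \<open>f\<close>. The trace operator is the
  continuous extension of \<open>\<phi> \<mapsto> \<phi>|\<^sub>S\<close> from smooth functions, here for the topology of
  \<open>H\<^sup>1_loc(U)\<close>, which is that of \<open>H\<^sup>1(U)\<close> when \<open>U\<close> is bounded.\<close>

definition has_trace ::
    "(real ^ 'm) set \<Rightarrow> (real ^ 'm) set \<Rightarrow> (real ^ 'm \<Rightarrow> complex) \<Rightarrow> (real ^ 'm \<Rightarrow> complex) \<Rightarrow> bool" where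
  "has_trace U S u f \<longleftrightarrow> f \<in> L2 (surface_measure S) \<and>
     (\<exists>\<phi>. (\<forall>j. \<phi> j \<in> test_functions UNIV) \<and>
          (\<forall>R. H1_tendsto (U \<inter> ball 0 R) \<phi> u) \<and>
          L2_tendsto (surface_measure S) \<phi> f)"


section \<open>Domains and the refractive index\<close>

definition domain :: "(real ^ 'm) set \<Rightarrow> bool" where
  "domain U \<longleftrightarrow> open U \<and> connected U \<and> U \<noteq> {}"

text \<open>Near each boundary point, \<open>U\<close> lies on one side of the graph, over the hyperplane orthogonal
  to some unit vector \<open>e\<close>, of a function with property \<open>P\<close>; a function of the hyperplane variable is
  identified with its extension that is constant along \<open>e\<close>.\<close>

definition locally_below_graph ::
    "((real ^ 'm \<Rightarrow> real) \<Rightarrow> bool) \<Rightarrow> (real ^ 'm) set \<Rightarrow> bool" where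
  "locally_below_graph P U \<longleftrightarrow> (\<forall>x\<in>frontier U. \<exists>e h V.
     norm e = 1 \<and> P h \<and> (\<forall>y t. h (y + t *\<^sub>R e) = h y) \<and>
     open V \<and> x \<in> V \<and> U \<inter> V = {y\<in>V. y \<bullet> e < h y})"

definition bounded_lipschitz_domain :: "(real ^ 'm) set \<Rightarrow> bool" where
  "bounded_lipschitz_domain U \<longleftrightarrow>
     domain U \<and> bounded U \<and> locally_below_graph (\<lambda>h. \<exists>L. L-lipschitz_on UNIV h) U"

definition smooth_boundary :: "(real ^ 'm) set \<Rightarrow> bool" where
  "smooth_boundary U \<longleftrightarrow> locally_below_graph (smooth_on UNIV) U"

text \<open>Polygonal curve (\<open>m = 2\<close>) or polyhedral surface (\<open>m = 3\<close>): a finite union of flat pieces.\<close>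

definition polyhedral_surface :: "(real ^ 'm) set \<Rightarrow> bool" where
  "polyhedral_surface S \<longleftrightarrow>
     (\<exists>F. finite F \<and> (\<forall>P\<in>F. polytope P \<and> aff_dim P = int CARD('m) - 1) \<and> S = \<Union>F)"

text \<open>Smooth up to the boundary on each of finitely many pieces; the values on the interfaces,
  a null set, are irrelevant.\<close>

definition piecewise_smooth :: "(real ^ 'm \<Rightarrow> real) \<Rightarrow> bool" where
  "piecewise_smooth n \<longleftrightarrow>
     (\<exists>\<U>. finite \<U> \<and> pairwise disjnt \<U> \<and> (\<Union>U\<in>\<U>. closure U) = UNIV \<and>
          (\<forall>U\<in>\<U>. open U \<and> negligible (frontier U) \<and>
                  (\<exists>g. smooth_on UNIV g \<and> (\<forall>x\<in>U. n x = g x))))"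


section \<open>Helmholtz problems\<close>

definition incident_wave :: "real \<Rightarrow> (real ^ 'm \<Rightarrow> complex) \<Rightarrow> bool" where
  "incident_wave k u \<longleftrightarrow>
     smooth_on UNIV u \<and> (\<forall>x. laplacian u x + (of_real k)\<^sup>2 * u x = 0)"

text \<open>\<open>\<Delta>u + k\<^sup>2 n\<^sup>2 u = 0\<close> in the open set \<open>U\<close>, in the sense of distributions.\<close>

definition helmholtz ::
    "real \<Rightarrow> (real ^ 'm \<Rightarrow> real) \<Rightarrow> (real ^ 'm) set \<Rightarrow> (real ^ 'm \<Rightarrow> complex) \<Rightarrow> bool" where
  "helmholtz k n U u \<longleftrightarrow> (\<forall>\<phi>\<in>test_functions U.
     (\<integral>x. u x * (laplacian \<phi> x + of_real (k\<^sup>2 * (n x)\<^sup>2) * \<phi> x) \<partial>lebesgue_on U) = 0)"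

text \<open>The Sommerfeld condition is a pointwise condition on the representative of \<open>u\<close> that is smooth
  near infinity (one exists for every solution of the Helmholtz equation outside a ball). The filter
  \<open>at_infinity\<close> makes it uniform in all directions.\<close>

definition radiating :: "real \<Rightarrow> (real ^ 'm \<Rightarrow> complex) \<Rightarrow> bool" where
  "radiating k u \<longleftrightarrow> (\<exists>R v. smooth_on {x. R < norm x} v \<and>
     (AE x in lebesgue_on {x. R < norm x}. u x = v x) \<and>
     (\<lambda>x. radial_deriv v x - \<i> * of_real k * v x)
       \<in> o[at_infinity](\<lambda>x. of_real (norm x powr (- (real CARD('m) - 1) / 2))))"

definition interior_solution ::
    "real \<Rightarrow> (real ^ 'm \<Rightarrow> real) \<Rightarrow> (real ^ 'm) set \<Rightarrow>
     (real ^ 'm \<Rightarrow> complex) \<Rightarrow> (real ^ 'm \<Rightarrow> complex) \<Rightarrow> bool" where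
  "interior_solution k n U f w \<longleftrightarrow>
     w \<in> H1 U \<and> helmholtz k n U w \<and> has_trace U (frontier U) w f"

text \<open>Here \<open>U\<close> is the bounded domain; the problem is posed in its exterior.\<close>

definition exterior_solution ::
    "real \<Rightarrow> (real ^ 'm) set \<Rightarrow> (real ^ 'm \<Rightarrow> complex) \<Rightarrow> (real ^ 'm \<Rightarrow> complex) \<Rightarrow> bool" where
  "exterior_solution k U f w \<longleftrightarrow>
     w \<in> H1_loc (- closure U) \<and> helmholtz k (\<lambda>_. 1) (- closure U) w \<and>
     has_trace (- closure U) (frontier U) w f \<and> radiating k w"

definition full_space_solution ::
    "real \<Rightarrow> (real ^ 'm \<Rightarrow> real) \<Rightarrow> (real ^ 'm \<Rightarrow> complex) \<Rightarrow> (real ^ 'm \<Rightarrow> complex) \<Rightarrow> bool" where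
  "full_space_solution k n uinc u \<longleftrightarrow>
     u \<in> H1_loc UNIV \<and> helmholtz k n UNIV u \<and> radiating k (\<lambda>x. u x - uinc x)"

definition unique_solution :: "'a measure \<Rightarrow> (('a \<Rightarrow> complex) \<Rightarrow> bool) \<Rightarrow> ('a \<Rightarrow> complex) \<Rightarrow> bool" where
  "unique_solution M P u \<longleftrightarrow> P u \<and> (\<forall>v. P v \<longrightarrow> (AE x in M. v x = u x))"

text \<open>The solution operators with values on the whole of \<open>U\<close>, respectively of its exterior. They
  return a representative, which is determined up to null sets when the problems are uniquely
  solvable.\<close>

definition K_int ::
    "real \<Rightarrow> (real ^ 'm \<Rightarrow> real) \<Rightarrow> (real ^ 'm) set \<Rightarrow> (real ^ 'm \<Rightarrow> complex) \<Rightarrow> real ^ 'm \<Rightarrow> complex" where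
  "K_int k n U f = (SOME w. interior_solution k n U f w)"

definition K_ext ::
    "real \<Rightarrow> (real ^ 'm) set \<Rightarrow> (real ^ 'm \<Rightarrow> complex) \<Rightarrow> real ^ 'm \<Rightarrow> complex" where
  "K_ext k U f = (SOME w. exterior_solution k U f w)"

text \<open>\<open>g\<close> is the boundary value on \<open>S\<close> of the solution with data \<open>f\<close>, i.e. the trace version
  of the two operators. The trace is two-sided when \<open>S\<close> lies inside the open set.\<close>

definition K_int_trace ::
    "real \<Rightarrow> (real ^ 'm \<Rightarrow> real) \<Rightarrow> (real ^ 'm) set \<Rightarrow> (real ^ 'm) set \<Rightarrow>
     (real ^ 'm \<Rightarrow> complex) \<Rightarrow> (real ^ 'm \<Rightarrow> complex) \<Rightarrow> bool" where
  "K_int_trace k n U S f g \<longleftrightarrow> has_trace U S (K_int k n U f) g"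

definition K_ext_trace ::
    "real \<Rightarrow> (real ^ 'm) set \<Rightarrow> (real ^ 'm) set \<Rightarrow>
     (real ^ 'm \<Rightarrow> complex) \<Rightarrow> (real ^ 'm \<Rightarrow> complex) \<Rightarrow> bool" where
  "K_ext_trace k U S f g \<longleftrightarrow> has_trace (- closure U) S (K_ext k U f) g"

end

theory Submission
  imports Defs
begin

text \<open>
  In the overlap \<open>\<Omega>\<^sub>1\<^sub>2\<close> both the interior field \<open>w\<close> with data \<open>f\<^sub>\<Sigma>\<close> and the total exterior field \<open>z + uinc\<close>,
  where \<open>z\<close> has data \<open>f\<^sub>\<Gamma>\<close>, solve the Helmholtz equation with \<open>n = 1\<close>. Their difference is an \<open>H\<^sup>1\<close>
  function, and the two equations of the interface system say exactly that its traces on \<open>\<Sigma>\<close> and \<open>\<Gamma>\<close>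
  vanish. The uniqueness assumption on \<open>\<Omega>\<^sub>1\<^sub>2\<close> therefore makes it zero. This step uses that traces are
  linear and may be restricted to subdomains (\<open>has_trace_lincomb\<close>, \<open>has_trace_subset\<close>), and that the
  incident wave is a distributional solution (\<open>incident_wave_helmholtz\<close>), which is Green's formula on
  the whole space, obtained from the translation invariance of Lebesgue measure.

  The function \<open>u\<close> then coincides almost everywhere with \<open>w\<close> on the open set \<open>\<Omega>\<^sub>2\<close> and with \<open>z + uinc\<close> on
  the open set \<open>\<Omega>\<^sub>1\<^sub>c\<close>. These sets cover the space, and being locally in \<open>H\<^sup>1\<close> and solving the Helmholtz
  equation are local properties: with a smooth cutoff \<open>\<theta>\<close> (\<open>smooth_cutoff\<close>) every test function splits
  into one supported in \<open>\<Omega>\<^sub>2\<close> and one supported in \<open>\<Omega>\<^sub>1\<^sub>c\<close> (\<open>H1_glue\<close>, \<open>helmholtz_glue\<close>). Outside a ball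
  \<open>u - uinc\<close> is \<open>z\<close>, which radiates. Hence \<open>u\<close> solves the full-space problem, and well-posedness of that
  problem makes it the unique solution.
\<close>

section \<open>Calculus of smooth functions\<close>

lemma partial_eqI:
  "(f has_derivative f') (at x) \<Longrightarrow> partial i f x = f' (axis i 1)"
  by (metis frechet_derivative_at partial_def)

text \<open>Counting the order of differentiability makes the closure properties of smooth functions
  provable by induction: the partial derivatives of a sum, product, composition or inverse are again
  built from functions whose order is known.\<close>

primrec times_differentiable :: "nat \<Rightarrow> (real ^ 'm \<Rightarrow> 'b::real_normed_vector) \<Rightarrow> bool" where
  "times_differentiable 0 f \<longleftrightarrow> (\<forall>x. f differentiable (at x))"
| "times_differentiable (Suc k) f \<longleftrightarrow>
     (\<forall>x. f differentiable (at x)) \<and> (\<forall>i. times_differentiable k (partial i f))"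

lemma times_differentiable_imp_differentiable: "times_differentiable k f \<Longrightarrow> f differentiable (at x)"
  by (cases k) auto

lemma times_differentiable_SucD: "times_differentiable (Suc k) f \<Longrightarrow> times_differentiable k f"
  by (induction k arbitrary: f) auto

lemma smooth_on_imp_differentiable: "smooth_on U f \<Longrightarrow> x \<in> U \<Longrightarrow> f differentiable (at x)"
  unfolding smooth_on_def by (metis foldr_Nil id_apply)

lemma smooth_on_partial: "smooth_on U f \<Longrightarrow> smooth_on U (partial i f)"
  unfolding smooth_on_def
proof (intro allI ballI)
  fix "is" x assume "\<forall>is. \<forall>x\<in>U. foldr partial is f differentiable at x" "x \<in> U"
  then have "foldr partial (is @ [i]) f differentiable at x" by blast
  then show "foldr partial is (partial i f) differentiable at x" by simp
qed

lemma smooth_on_UNIV_iff: "smooth_on UNIV f \<longleftrightarrow> (\<forall>k. times_differentiable k f)"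
proof
  assume "smooth_on UNIV f"
  then have "times_differentiable k f" for k
  proof (induction k arbitrary: f)
    case 0 then show ?case by (simp add: smooth_on_imp_differentiable)
  next
    case (Suc k) then show ?case by (simp add: smooth_on_imp_differentiable smooth_on_partial)
  qed
  then show "\<forall>k. times_differentiable k f" by blast
next
  assume f: "\<forall>k. times_differentiable k f"
  have *: "times_differentiable k (foldr partial is f)" for k "is"
  proof (induction "is" arbitrary: k)
    case (Cons i "is")
    have "times_differentiable (Suc k) (foldr partial is f)" by (rule Cons.IH)
    then show ?case by simp
  qed (use f in simp)
  show "smooth_on UNIV f"
    unfolding smooth_on_def using times_differentiable_imp_differentiable[OF *[of 0]] by blast
qed

lemma smooth_const: "smooth_on UNIV (\<lambda>x. c)"
proof -
  have "times_differentiable k (\<lambda>x::real^'m. c)" for k and c :: 'b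
  proof (induction k arbitrary: c)
    case (Suc k)
    have "partial i (\<lambda>x::real^'m. c) = (\<lambda>x. 0)" for i
      by (rule ext, rule partial_eqI) simp
    then show ?case using Suc by auto
  qed simp
  then show ?thesis unfolding smooth_on_UNIV_iff by blast
qed

lemma partial_linear:
  fixes f :: "real ^ 'm \<Rightarrow> 'b::real_normed_vector"
  assumes "bounded_linear T" "\<And>x. f differentiable (at x)"
  shows "partial i (\<lambda>x. T (f x)) = (\<lambda>x. T (partial i f x))"
proof
  fix x
  have "((\<lambda>x. T (f x)) has_derivative (\<lambda>h. T (frechet_derivative f (at x) h))) (at x)"
    by (rule bounded_linear.has_derivative[OF assms(1)]) (use assms(2) frechet_derivative_works in blast)
  then show "partial i (\<lambda>x. T (f x)) x = T (partial i f x)"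
    by (simp add: partial_eqI) (simp add: partial_def)
qed

lemma smooth_linear:
  fixes f :: "real ^ 'm \<Rightarrow> 'b::real_normed_vector"
  assumes T: "bounded_linear T" and f: "smooth_on UNIV f"
  shows "smooth_on UNIV (\<lambda>x. T (f x))"
proof -
  have diff: "(\<lambda>x. T (f x)) differentiable (at x)" if "smooth_on UNIV f" for f :: "real ^ 'm \<Rightarrow> 'b" and x
    using smooth_on_imp_differentiable[OF that, of x] bounded_linear.has_derivative[OF T]
    unfolding differentiable_def by blast
  have "times_differentiable k (\<lambda>x. T (f x))" for k
    using f
  proof (induction k arbitrary: f)
    case (Suc k)
    then show ?case
      using diff by (simp add: partial_linear[OF T] smooth_on_imp_differentiable smooth_on_partial)
  qed (use diff in simp)
  then show ?thesis unfolding smooth_on_UNIV_iff by blast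
qed

lemma smooth_coordinate: "smooth_on UNIV (\<lambda>x :: real ^ 'm. x $ j)"
proof -
  have "times_differentiable k (\<lambda>x::real^'m. x $ j)" for k
  proof (cases k)
    case (Suc l)
    have "partial i (\<lambda>x::real^'m. x $ j) = (\<lambda>x. axis i 1 $ j)" for i
      by (rule ext, rule partial_eqI) (auto intro!: bounded_linear_imp_has_derivative bounded_linear_vec_nth)
    moreover have "times_differentiable l (\<lambda>x::real^'m. axis i (1::real) $ j)" for i
      using smooth_const smooth_on_UNIV_iff by blast
    ultimately show ?thesis using Suc
      by (simp add: bounded_linear_imp_differentiable bounded_linear_vec_nth)
  qed (simp add: bounded_linear_imp_differentiable bounded_linear_vec_nth)
  then show ?thesis unfolding smooth_on_UNIV_iff by blast
qed

lemma partial_add: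
  assumes "\<And>x. f differentiable (at x)" "\<And>x. g differentiable (at x)"
  shows "partial i (\<lambda>x. f x + g x) = (\<lambda>x. partial i f x + partial i g x)"
proof
  fix x
  have "((\<lambda>x. f x + g x) has_derivative
      (\<lambda>h. frechet_derivative f (at x) h + frechet_derivative g (at x) h)) (at x)"
    by (intro has_derivative_add) (use assms frechet_derivative_works in blast)+
  then show "partial i (\<lambda>x. f x + g x) x = partial i f x + partial i g x"
    by (simp add: partial_eqI) (simp add: partial_def)
qed

lemma partial_mult:
  fixes f g :: "real ^ 'm \<Rightarrow> 'b::real_normed_algebra"
  assumes "\<And>x. f differentiable (at x)" "\<And>x. g differentiable (at x)"
  shows "partial i (\<lambda>x. f x * g x) = (\<lambda>x. f x * partial i g x + partial i f x * g x)"
proof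
  fix x
  have "((\<lambda>x. f x * g x) has_derivative
      (\<lambda>h. f x * frechet_derivative g (at x) h + frechet_derivative f (at x) h * g x)) (at x)"
    by (intro has_derivative_mult) (use assms frechet_derivative_works in blast)+
  then show "partial i (\<lambda>x. f x * g x) x = f x * partial i g x + partial i f x * g x"
    by (simp add: partial_eqI) (simp add: partial_def)
qed

lemma times_differentiable_add:
  "times_differentiable k f \<Longrightarrow> times_differentiable k g \<Longrightarrow> times_differentiable k (\<lambda>x. f x + g x)"
  by (induction k arbitrary: f g) (simp_all add: partial_add)

lemma smooth_add:
  "smooth_on UNIV f \<Longrightarrow> smooth_on UNIV g \<Longrightarrow> smooth_on UNIV (\<lambda>x. f x + g x)"
  unfolding smooth_on_UNIV_iff using times_differentiable_add by blast

lemma times_differentiable_mult: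
  fixes f g :: "real ^ 'm \<Rightarrow> 'b::real_normed_algebra"
  shows "times_differentiable k f \<Longrightarrow> times_differentiable k g \<Longrightarrow> times_differentiable k (\<lambda>x. f x * g x)"
proof (induction k arbitrary: f g)
  case (Suc k)
  then have "times_differentiable k f" "times_differentiable k g"
    by (auto intro: times_differentiable_SucD)
  with Suc show ?case
    by (simp add: partial_mult times_differentiable_add)
qed simp

lemma smooth_mult:
  fixes f g :: "real ^ 'm \<Rightarrow> 'b::real_normed_algebra"
  shows "smooth_on UNIV f \<Longrightarrow> smooth_on UNIV g \<Longrightarrow> smooth_on UNIV (\<lambda>x. f x * g x)"
  unfolding smooth_on_UNIV_iff using times_differentiable_mult by blast

lemma smooth_uminus: "smooth_on UNIV f \<Longrightarrow> smooth_on UNIV (\<lambda>x. - f x)"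
  by (rule smooth_linear[of uminus, OF bounded_linear_minus[OF bounded_linear_ident]])

lemma smooth_diff:
  "smooth_on UNIV f \<Longrightarrow> smooth_on UNIV g \<Longrightarrow> smooth_on UNIV (\<lambda>x. f x - g x)"
  using smooth_add[of f "\<lambda>x. - g x"] smooth_uminus[of g] by simp

lemma smooth_sum:
  "(\<And>j. j \<in> J \<Longrightarrow> smooth_on UNIV (f j)) \<Longrightarrow> smooth_on UNIV (\<lambda>x. \<Sum>j\<in>J. f j x)"
  by (induction J rule: infinite_finite_induct) (simp_all add: smooth_const smooth_add)

text \<open>Induction on the order of differentiability: the chain rule turns a derivative of \<open>g \<circ> F\<close> into a
  product of \<open>g' \<circ> F\<close> with a smooth function, and \<open>g'\<close> lies again in the class \<open>G\<close>.\<close>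

lemma smooth_compose:
  assumes "g \<in> G" and G: "\<And>g. g \<in> G \<Longrightarrow> \<exists>g'\<in>G. \<forall>t. (g has_real_derivative g' t) (at t)"
    and F: "smooth_on UNIV F"
  shows "smooth_on UNIV (\<lambda>x. g (F x))"
proof -
  have diff: "(\<lambda>x. g (F x)) differentiable (at x)" if "g \<in> G" for g x
    using G[OF that] smooth_on_imp_differentiable[OF F]
    by (metis UNIV_I differentiable_compose differentiable_def has_field_derivative_def)
  have "times_differentiable k (\<lambda>x. g (F x))" if "g \<in> G" for k g
    using that
  proof (induction k arbitrary: g)
    case (Suc k)
    then obtain g' where g': "g' \<in> G" "\<And>t. (g has_real_derivative g' t) (at t)" using G by blast
    have "partial i (\<lambda>x. g (F x)) = (\<lambda>x. g' (F x) * partial i F x)" for i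
    proof
      fix x
      have "((\<lambda>x. g (F x)) has_derivative (\<lambda>h. g' (F x) * frechet_derivative F (at x) h)) (at x)"
        by (rule has_derivative_compose[OF _ g'(2)[unfolded has_field_derivative_def]])
           (use smooth_on_imp_differentiable[OF F] frechet_derivative_works in blast)
      then show "partial i (\<lambda>x. g (F x)) x = g' (F x) * partial i F x"
        by (simp add: partial_eqI) (simp add: partial_def)
    qed
    then show ?case
      using Suc.IH[OF g'(1)] diff[OF Suc.prems] smooth_on_partial[OF F]
      by (simp add: times_differentiable_mult smooth_on_UNIV_iff)
  qed (simp add: diff)
  then show ?thesis using assms(1) unfolding smooth_on_UNIV_iff by blast
qed

text \<open>The derivatives of \<open>1/h\<close> are products of smooth functions with powers of \<open>1/h\<close> itself, so that
  the induction hypothesis for \<open>1/h\<close> already covers the factors of its own derivative.\<close>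

lemma smooth_inverse:
  fixes h :: "real ^ 'm \<Rightarrow> real"
  assumes h: "smooth_on UNIV h" and nz: "\<And>x. h x \<noteq> 0"
  shows "smooth_on UNIV (\<lambda>x. inverse (h x))"
proof -
  have "((\<lambda>x. inverse (h x)) has_derivative
          (\<lambda>d. - (inverse (h x) * frechet_derivative h (at x) d * inverse (h x)))) (at x)" for x
    using nz smooth_on_imp_differentiable[OF h, of x]
    by (intro Deriv.has_derivative_inverse) (simp_all add: frechet_derivative_works)
  note d = this
  have diff: "(\<lambda>x. inverse (h x)) differentiable (at x)" for x
    using d unfolding differentiable_def by blast
  have eq: "partial i (\<lambda>x. inverse (h x)) x = (- partial i h x) * (inverse (h x) * inverse (h x))" for x i
    unfolding partial_eqI[OF d] by (simp add: partial_def)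
  have "times_differentiable k (\<lambda>x. inverse (h x))" for k
  proof (induction k)
    case (Suc k)
    have "times_differentiable k (\<lambda>x. - partial i h x)" for i
      using smooth_uminus[OF smooth_on_partial[OF h]] smooth_on_UNIV_iff by blast
    then have "times_differentiable k (\<lambda>x. - partial i h x * (inverse (h x) * inverse (h x)))" for i
      using Suc by (intro times_differentiable_mult)
    then show ?case
      using diff by (simp add: eq[abs_def])
  qed (simp add: diff)
  then show ?thesis unfolding smooth_on_UNIV_iff by blast
qed

lemma smooth_on_imp_continuous: "smooth_on UNIV f \<Longrightarrow> continuous_on S f"
  by (meson UNIV_I continuous_at_imp_continuous_on differentiable_imp_continuous_within
      smooth_on_imp_differentiable)

section \<open>Smooth cutoff functions\<close>

text \<open>The function \<open>flat 1\<close> is the classical smooth function \<open>exp (-1/t)\<close> that vanishes to all orders at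
  \<open>0\<close>. The polynomial factor makes the family closed under differentiation.\<close>

definition flat :: "real poly \<Rightarrow> real \<Rightarrow> real" where
  "flat p t = (if t > 0 then poly p (1 / t) * exp (- (1 / t)) else 0)"

lemma tendsto_poly_times_exp_minus:
  fixes p :: "real poly"
  shows "((\<lambda>t. poly p t * exp (- t)) \<longlongrightarrow> 0) at_top"
proof -
  have "((\<lambda>t. \<Sum>i\<le>degree p. coeff p i * (t ^ i / exp t)) \<longlongrightarrow> (\<Sum>i\<le>degree p. coeff p i * 0)) at_top"
    by (intro tendsto_intros tendsto_power_div_exp_0)
  then show ?thesis
    by (simp add: poly_altdef exp_minus divide_inverse sum_distrib_right mult.assoc)
qed

lemma flat_tendsto_0: "(flat p \<longlongrightarrow> 0) (at_right 0)"
proof -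
  have "((\<lambda>t. poly p (inverse t) * exp (- inverse t)) \<longlongrightarrow> 0) (at_right 0)"
    by (rule filterlim_compose[OF tendsto_poly_times_exp_minus filterlim_inverse_at_top_right])
  then show ?thesis
    by (rule Lim_transform_eventually)
       (auto simp: eventually_at_filter flat_def inverse_eq_divide)
qed

text \<open>At \<open>t = 0\<close> the difference quotient from the right is again a member of the family, with
  polynomial \<open>X p\<close>, and so it tends to \<open>0\<close>.\<close>

lemma flat_has_derivative:
  "(flat p has_real_derivative flat (monom 1 2 * (p - pderiv p)) t) (at t)"
proof -
  consider "t > 0" | "t < 0" | "t = 0" by linarith
  then show ?thesis
  proof cases
    case 1
    have "((\<lambda>t. poly p (1 / t) * exp (- (1 / t))) has_real_derivative
        flat (monom 1 2 * (p - pderiv p)) t) (at t)"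
      using 1 by (auto intro!: derivative_eq_intros DERIV_chain2[OF poly_DERIV]
          simp: flat_def poly_monom power2_eq_square field_simps)
    then show ?thesis
      by (rule DERIV_cong_ev[THEN iffD1, rotated 3])
         (use 1 in \<open>auto simp: flat_def eventually_nhds intro!: exI[of _ "{0<..}"]\<close>)
  next
    case 2
    have "((\<lambda>t. 0) has_real_derivative flat (monom 1 2 * (p - pderiv p)) t) (at t)"
      using 2 by (auto simp: flat_def)
    then show ?thesis
      by (rule DERIV_cong_ev[THEN iffD1, rotated 3])
         (use 2 in \<open>auto simp: flat_def eventually_nhds intro!: exI[of _ "{..<0}"]\<close>)
  next
    case 3
    have "((\<lambda>h. (flat p h - flat p 0) / (h - 0)) \<longlongrightarrow> 0) (at_right 0)"
      by (rule Lim_transform_eventually[OF flat_tendsto_0[of "pCons 0 p"]])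
         (auto simp: eventually_at_filter flat_def)
    moreover have "((\<lambda>h. (flat p h - flat p 0) / (h - 0)) \<longlongrightarrow> 0) (at_left 0)"
      by (rule Lim_transform_eventually[OF tendsto_const])
         (auto simp: eventually_at_filter flat_def)
    ultimately show ?thesis
      using 3 by (simp add: has_field_derivative_iff filterlim_split_at flat_def)
  qed
qed

lemma smooth_flat: "smooth_on UNIV F \<Longrightarrow> smooth_on UNIV (\<lambda>x. flat p (F x))"
  by (rule smooth_compose[of _ "range flat"]) (use flat_has_derivative in blast)+

lemma flat_one: "flat 1 t \<ge> 0" "flat 1 t = 0 \<longleftrightarrow> t \<le> 0"
  by (auto simp: flat_def)

text \<open>A finite sum \<open>F\<close> of bumps on balls inside \<open>U\<close> is bounded below on \<open>K\<close> by some \<open>\<epsilon> > 0\<close>. Composing it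
  with the smooth step \<open>flat 1 s / (flat 1 s + flat 1 (\<epsilon> - s))\<close>, which is \<open>0\<close> for \<open>s \<le> 0\<close> and \<open>1\<close> for
  \<open>s \<ge> \<epsilon>\<close>, gives a cutoff that equals \<open>1\<close> near \<open>K\<close> and not only on it.\<close>

lemma smooth_cutoff:
  fixes K U :: "(real ^ 'm) set"
  assumes "compact K" "open U" "K \<subseteq> U"
  obtains \<theta> :: "real ^ 'm \<Rightarrow> complex" and N where "smooth_on UNIV \<theta>" "closure {x. \<theta> x \<noteq> 0} \<subseteq> U"
    "open N" "K \<subseteq> N" "\<And>x. x \<in> N \<Longrightarrow> \<theta> x = 1"
    "\<And>x. cmod (\<theta> x) \<le> 1"
proof -
  have "\<forall>a\<in>K. \<exists>r>0. cball a r \<subseteq> U"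
    using assms open_contains_cball by blast
  then obtain r where r: "\<And>a. a \<in> K \<Longrightarrow> r a > 0" "\<And>a. a \<in> K \<Longrightarrow> cball a (r a) \<subseteq> U" by metis
  obtain A where A: "A \<subseteq> K" "finite A" "K \<subseteq> (\<Union>a\<in>A. ball a (r a))"
    using compactE_image[OF assms(1), of K "\<lambda>a. ball a (r a)"] r(1) by force
  define F where "F x = (\<Sum>a\<in>A. flat 1 ((r a)\<^sup>2 - (\<Sum>j\<in>UNIV. (x $ j - a $ j) * (x $ j - a $ j))))" for x
  have F: "smooth_on UNIV F"
    unfolding F_def[abs_def]
    by (intro smooth_sum smooth_flat smooth_diff smooth_mult smooth_coordinate smooth_const)
  have dist: "(\<Sum>j\<in>UNIV. (x $ j - a $ j) * (x $ j - a $ j)) = (dist a x)\<^sup>2" for a x :: "real ^ 'm"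
    unfolding dist_norm power2_norm_eq_inner inner_vec_def
    by (simp add: algebra_simps)
  have in_ball: "flat 1 ((r a)\<^sup>2 - (dist a x)\<^sup>2) = 0 \<longleftrightarrow> x \<notin> ball a (r a)" if "a \<in> A" for a x
    using r(1)[of a] that A(1) by (auto simp: flat_one not_less abs_le_square_iff[symmetric])
  have F0: "F x = 0 \<longleftrightarrow> x \<notin> (\<Union>a\<in>A. ball a (r a))" for x
    unfolding F_def dist using A(2) by (subst sum_nonneg_eq_0_iff) (auto simp: flat_one(1) in_ball)
  have F_nonneg: "F x \<ge> 0" for x
    unfolding F_def by (intro sum_nonneg) (simp add: flat_one)
  obtain \<epsilon> where \<epsilon>: "\<epsilon> > 0" "\<And>x. x \<in> K \<Longrightarrow> F x > \<epsilon>"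
  proof (cases "K = {}")
    case False
    then obtain y where "y \<in> K" "\<And>x. x \<in> K \<Longrightarrow> F y \<le> F x"
      using continuous_attains_inf[OF assms(1) _ smooth_on_imp_continuous[OF F]] by blast
    moreover have "F y > 0" using F0[of y] F_nonneg[of y] A(3) \<open>y \<in> K\<close> by force
    ultimately show ?thesis using that[of "F y / 2"] by fastforce
  qed (use that[of 1] in simp)
  define c where "c x = flat 1 (F x) * inverse (flat 1 (F x) + flat 1 (\<epsilon> - F x))" for x
  have pos: "flat 1 (F x) + flat 1 (\<epsilon> - F x) \<noteq> 0" for x
    using \<epsilon>(1) F_nonneg[of x] by (simp add: add_nonneg_eq_0_iff flat_one)
  have "smooth_on UNIV c"
    unfolding c_def[abs_def]
    by (intro smooth_mult smooth_inverse smooth_add smooth_diff smooth_flat F smooth_const pos)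
  then have 1: "smooth_on UNIV (\<lambda>x. complex_of_real (c x))"
    by (rule smooth_linear[OF bounded_linear_of_real])
  have "{x. complex_of_real (c x) \<noteq> 0} \<subseteq> (\<Union>a\<in>A. cball a (r a))"
  proof
    fix x assume "x \<in> {x. complex_of_real (c x) \<noteq> 0}"
    then have "F x \<noteq> 0" using flat_one(2)[of 0] by (auto simp: c_def)
    then show "x \<in> (\<Union>a\<in>A. cball a (r a))" unfolding F0 by fastforce
  qed
  moreover have "closed (\<Union>a\<in>A. cball a (r a))" using A(2) by blast
  ultimately have "closure {x. complex_of_real (c x) \<noteq> 0} \<subseteq> (\<Union>a\<in>A. cball a (r a))"
    by (rule closure_minimal)
  then have 2: "closure {x. complex_of_real (c x) \<noteq> 0} \<subseteq> U" using r(2) A(1) by blast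
  have 3: "open {x. F x > \<epsilon>}"
    by (rule open_Collect_less) (simp_all add: smooth_on_imp_continuous[OF F])
  have "complex_of_real (c x) = 1" if "x \<in> {x. F x > \<epsilon>}" for x
    using that \<epsilon>(1) flat_one(2)[of "\<epsilon> - F x"] flat_one(2)[of "F x"] by (simp add: c_def)
  moreover have "cmod (complex_of_real (c x)) \<le> 1" for x
    unfolding norm_of_real
    using pos[of x] flat_one(1)[of "F x"] flat_one(1)[of "\<epsilon> - F x"]
    by (simp add: c_def divide_inverse[symmetric])
  ultimately show thesis
    using 1 2 3 \<epsilon>(2) that[of "\<lambda>x. complex_of_real (c x)" "{x. F x > \<epsilon>}"] by blast
qed

section \<open>Test functions\<close>

lemma zero_outside_support: "x \<notin> closure {x. f x \<noteq> 0} \<Longrightarrow> f x = 0"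
  using closure_subset[of "{x. f x \<noteq> 0}"] by blast

lemma test_functionsD:
  assumes "\<phi> \<in> test_functions U"
  shows "smooth_on UNIV \<phi>" "\<phi> differentiable (at x)" "continuous_on S \<phi>" "x \<notin> U \<Longrightarrow> \<phi> x = 0"
proof -
  show s: "smooth_on UNIV \<phi>" using assms by (simp add: test_functions_def)
  show "\<phi> differentiable (at x)" by (rule smooth_on_imp_differentiable[OF s]) simp
  show "continuous_on S \<phi>" by (rule smooth_on_imp_continuous[OF s])
  show "x \<notin> U \<Longrightarrow> \<phi> x = 0"
    using assms zero_outside_support[of x \<phi>] by (auto simp: test_functions_def)
qed

lemma test_functions_mono: "\<phi> \<in> test_functions U \<Longrightarrow> U \<subseteq> V \<Longrightarrow> \<phi> \<in> test_functions V"
  by (auto simp: test_functions_def)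

lemma test_functionsI:
  assumes "smooth_on UNIV \<psi>" "\<phi> \<in> test_functions U" "closure {x. \<psi> x \<noteq> 0} \<subseteq> closure {x. \<phi> x \<noteq> 0}"
  shows "\<psi> \<in> test_functions U"
proof -
  have "compact (closure {x. \<phi> x \<noteq> 0} \<inter> closure {x. \<psi> x \<noteq> 0})"
    using assms(2) by (intro compact_Int_closed) (auto simp: test_functions_def)
  then show ?thesis
    using assms by (auto simp: test_functions_def Int_absorb1)
qed

lemma test_functions_mult:
  assumes "smooth_on UNIV f" "\<phi> \<in> test_functions U"
  shows "(\<lambda>x. f x * \<phi> x) \<in> test_functions U"
  by (rule test_functionsI[OF _ assms(2)])
     (auto intro!: smooth_mult closure_mono assms test_functionsD(1)[OF assms(2)])

lemma test_functions_mult_Int: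
  assumes "smooth_on UNIV f" "closure {x. f x \<noteq> 0} \<subseteq> V" "\<phi> \<in> test_functions U"
  shows "(\<lambda>x. f x * \<phi> x) \<in> test_functions (V \<inter> U)"
proof -
  have "closure {x. f x * \<phi> x \<noteq> 0} \<subseteq> closure {x. f x \<noteq> 0}"
    by (rule closure_mono) auto
  then show ?thesis
    using test_functions_mult[OF assms(1,3)] assms(2) by (auto simp: test_functions_def)
qed

lemma test_functions_add:
  assumes "\<phi> \<in> test_functions U" "\<psi> \<in> test_functions U"
  shows "(\<lambda>x. \<phi> x + \<psi> x) \<in> test_functions U"
proof -
  let ?K = "closure {x. \<phi> x \<noteq> 0} \<union> closure {x. \<psi> x \<noteq> 0}"
  have K: "compact ?K" "?K \<subseteq> U"
    using assms by (auto simp: test_functions_def)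
  have sub: "closure {x. \<phi> x + \<psi> x \<noteq> 0} \<subseteq> ?K"
    unfolding closure_Un[symmetric] by (rule closure_mono) auto
  then have "compact (?K \<inter> closure {x. \<phi> x + \<psi> x \<noteq> 0})"
    by (intro compact_Int_closed K) auto
  then show ?thesis
    using K sub smooth_add[OF assms[THEN test_functionsD(1)]]
    by (auto simp: test_functions_def Int_absorb1)
qed

lemma test_functions_cmult: "\<phi> \<in> test_functions U \<Longrightarrow> (\<lambda>x. c * \<phi> x) \<in> test_functions U"
  by (rule test_functions_mult[OF smooth_const])

lemma test_functions_partial:
  assumes "\<phi> \<in> test_functions U"
  shows "partial i \<phi> \<in> test_functions U"
proof (rule test_functionsI[OF smooth_on_partial[OF test_functionsD(1)[OF assms]] assms])
  have "partial i \<phi> x = 0" if "x \<notin> closure {x. \<phi> x \<noteq> 0}" for x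
  proof -
    have "(\<phi> has_derivative (\<lambda>_. 0)) (at x)"
    proof (rule has_derivative_transform_within_open)
      show "((\<lambda>_. 0) has_derivative (\<lambda>_. 0)) (at x)" by simp
      show "open (- closure {x. \<phi> x \<noteq> 0})" "x \<in> - closure {x. \<phi> x \<noteq> 0}" using that by auto
      show "0 = \<phi> y" if "y \<in> - closure {x. \<phi> x \<noteq> 0}" for y
        using zero_outside_support[of y \<phi>] that by simp
    qed
    then show ?thesis by (simp add: partial_eqI)
  qed
  then show "closure {x. partial i \<phi> x \<noteq> 0} \<subseteq> closure {x. \<phi> x \<noteq> 0}"
    by (intro closure_minimal) auto
qed

lemma test_functions_0: "(\<lambda>x. 0) \<in> test_functions U"
  by (simp add: test_functions_def smooth_const)

lemma test_functions_sum:
  "(\<And>j. j \<in> J \<Longrightarrow> \<phi> j \<in> test_functions U) \<Longrightarrow> (\<lambda>x. \<Sum>j\<in>J. \<phi> j x) \<in> test_functions U"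
  by (induction J rule: infinite_finite_induct) (simp_all add: test_functions_0 test_functions_add)

lemma test_functions_laplacian:
  assumes "\<phi> \<in> test_functions U"
  shows "laplacian \<phi> \<in> test_functions U"
  unfolding laplacian_def[abs_def] using assms
  by (intro test_functions_sum test_functions_partial)

lemma laplacian_add:
  assumes "\<phi> \<in> test_functions U" "\<psi> \<in> test_functions V"
  shows "laplacian (\<lambda>x. \<phi> x + \<psi> x) x = laplacian \<phi> x + laplacian \<psi> x"
  by (simp add: laplacian_def sum.distrib partial_add
      test_functionsD(2)[OF assms(1)] test_functionsD(2)[OF assms(2)]
      test_functionsD(2)[OF test_functions_partial[OF assms(1)]]
      test_functionsD(2)[OF test_functions_partial[OF assms(2)]])

section \<open>Integration by parts\<close>

lemma integrable_compact_support:
  fixes f :: "real ^ 'm \<Rightarrow> 'b::euclidean_space"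
  assumes "continuous_on UNIV f" "compact K" "\<And>x. x \<notin> K \<Longrightarrow> f x = 0"
  shows "integrable lborel f"
proof -
  have "integrable lborel (\<lambda>x. indicator K x *\<^sub>R f x)"
    using assms by (intro borel_integrable_compact) (auto intro: continuous_on_subset)
  moreover have "(\<lambda>x. indicator K x *\<^sub>R f x) = f" using assms(3) by (auto simp: indicator_def)
  ultimately show ?thesis by simp
qed

lemma test_functions_integrable:
  assumes "\<phi> \<in> test_functions U"
  shows "integrable lborel \<phi>" "integrable lebesgue \<phi>"
proof -
  show *: "integrable lborel \<phi>"
  proof (rule integrable_compact_support[OF test_functionsD(3)[OF assms]])
    show "compact (closure {x. \<phi> x \<noteq> 0})" using assms by (simp add: test_functions_def)
  qed (rule zero_outside_support)
  then show "integrable lebesgue \<phi>"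
    by (subst integrable_completion) auto
qed

text \<open>The integrals of the difference quotients of \<open>\<phi>\<close> vanish by translation invariance, and they
  converge to the integral of the derivative.\<close>

lemma integral_partial_test_function:
  assumes \<phi>: "\<phi> \<in> test_functions U"
  shows "(\<integral>x. partial i \<phi> x \<partial>lebesgue) = 0"
proof -
  note p = test_functions_partial[OF \<phi>, of i]
  let ?e = "axis i 1 :: real ^ 'a"
  have cont: "continuous_on UNIV \<phi>" "continuous_on UNIV (partial i \<phi>)"
    using test_functionsD(3)[OF \<phi>] test_functionsD(3)[OF p] .
  have meas[measurable]: "\<phi> \<in> borel_measurable borel" "partial i \<phi> \<in> borel_measurable borel"
    using cont by (auto intro: borel_measurable_continuous_onI)
  define q where "q j x = real (Suc j) *\<^sub>R (\<phi> (?e /\<^sub>R real (Suc j) + x) - \<phi> x)" for j x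
  have deriv: "((\<lambda>t. \<phi> (x + t *\<^sub>R ?e)) has_vector_derivative partial i \<phi> (x + t *\<^sub>R ?e)) (at t)" for x t
  proof -
    let ?D = "frechet_derivative \<phi> (at (x + t *\<^sub>R ?e))"
    have D: "(\<phi> has_derivative ?D) (at (x + t *\<^sub>R ?e))"
      using test_functionsD(2)[OF \<phi>] frechet_derivative_works by blast
    have "((\<lambda>t. \<phi> (x + t *\<^sub>R ?e)) has_derivative (\<lambda>h. ?D (h *\<^sub>R ?e))) (at t)"
      by (rule has_derivative_compose[where g = \<phi> and f = "\<lambda>t. x + t *\<^sub>R ?e", OF _ D]) (auto intro!: derivative_eq_intros)
    then show ?thesis
      by (simp add: has_vector_derivative_def partial_def linear_cmul[OF has_derivative_linear[OF D]])
  qed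
  have "compact (closure {x. partial i \<phi> x \<noteq> 0})"
    using p by (auto simp: test_functions_def)
  then have "bounded (partial i \<phi> ` closure {x. partial i \<phi> x \<noteq> 0})"
    using cont(2) by (meson compact_continuous_image compact_imp_bounded continuous_on_subset subset_UNIV)
  then obtain B where B0: "B > 0"
      and B': "\<And>y. y \<in> partial i \<phi> ` closure {x. partial i \<phi> x \<noteq> 0} \<Longrightarrow> norm y \<le> B"
    using bounded_pos by metis
  have B: "norm (partial i \<phi> x) \<le> B" for x
    using B'[of "partial i \<phi> x"] B0 closure_subset[of "{x. partial i \<phi> x \<noteq> 0}"]
    by (cases "partial i \<phi> x = 0") auto
  have "bounded (closure {x. \<phi> x \<noteq> 0})" 
    using \<phi> by (auto simp: test_functions_def compact_imp_bounded)
  then obtain R where R: "\<And>x. x \<in> closure {x. \<phi> x \<noteq> 0} \<Longrightarrow> norm x \<le> R" 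
    unfolding bounded_iff by blast
  have R: "\<phi> x = 0" if "norm x > R" for x
    using R[of x] that closure_subset[of "{x. \<phi> x \<noteq> 0}"] by fastforce
  have lim: "(\<lambda>j. q j x) \<longlonglongrightarrow> partial i \<phi> x" for x
  proof -
    have "((\<lambda>t. (\<phi> (x + t *\<^sub>R ?e) - \<phi> x) /\<^sub>R t) \<longlongrightarrow> partial i \<phi> x) (at 0)"
    proof -
      have 1: "((\<lambda>t. norm (\<phi> (x + t *\<^sub>R ?e) - \<phi> x - t *\<^sub>R partial i \<phi> x) / norm t) \<longlongrightarrow> 0) (at 0)"
        using deriv[of x 0] by (simp add: has_vector_derivative_def has_derivative_at)
      have 2: "norm (\<phi> (x + t *\<^sub>R ?e) - \<phi> x - t *\<^sub>R partial i \<phi> x) / norm t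
          = norm ((\<phi> (x + t *\<^sub>R ?e) - \<phi> x) /\<^sub>R t - partial i \<phi> x)" if "t \<noteq> 0" for t
      proof -
        have "(\<phi> (x + t *\<^sub>R ?e) - \<phi> x) /\<^sub>R t - partial i \<phi> x
            = (\<phi> (x + t *\<^sub>R ?e) - \<phi> x - t *\<^sub>R partial i \<phi> x) /\<^sub>R t"
          using that by (simp only: scaleR_diff_right) simp
        then show ?thesis by (simp add: divide_inverse mult.commute)
      qed
      have "((\<lambda>t. norm ((\<phi> (x + t *\<^sub>R ?e) - \<phi> x) /\<^sub>R t - partial i \<phi> x)) \<longlongrightarrow> 0) (at 0)"
        by (rule Lim_transform_eventually[OF 1])
           (use 2 in \<open>auto simp: eventually_at_filter intro!: always_eventually\<close>)
      then show ?thesis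
        by (subst Lim_null) (simp only: tendsto_norm_zero_iff)
    qed
    moreover have "filterlim (\<lambda>j. inverse (real (Suc j))) (at 0) sequentially"
      using LIMSEQ_inverse_real_of_nat by (auto simp: filterlim_at)
    ultimately have "(\<lambda>j. (\<phi> (x + inverse (real (Suc j)) *\<^sub>R ?e) - \<phi> x) /\<^sub>R inverse (real (Suc j)))
        \<longlonglongrightarrow> partial i \<phi> x"
      by (rule filterlim_compose)
    then show ?thesis by (simp add: q_def[abs_def] add.commute)
  qed
  have bound: "norm (q j x) \<le> indicator (cball 0 (R + 1)) x *\<^sub>R B" for j x
  proof (cases "norm x \<le> R + 1")
    case True
    let ?h = "inverse (real (Suc j))"
    have "norm (\<phi> (x + ?h *\<^sub>R ?e) - \<phi> (x + 0 *\<^sub>R ?e)) \<le> B * norm (?h - 0)"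
      by (rule differentiable_bound[of UNIV "\<lambda>t. \<phi> (x + t *\<^sub>R ?e)"
            "\<lambda>t h. h *\<^sub>R partial i \<phi> (x + t *\<^sub>R ?e)"])
         (use deriv B in \<open>auto simp: has_vector_derivative_def mult.commute[of B]
            intro!: onorm_le mult_left_mono\<close>)
    then have "real (Suc j) * norm (\<phi> (x + ?h *\<^sub>R ?e) - \<phi> x) \<le> B"
      by (simp add: field_simps del: of_nat_Suc)
    moreover have "norm (q j x) = real (Suc j) * norm (\<phi> (x + ?h *\<^sub>R ?e) - \<phi> x)"
      by (simp only: q_def norm_scaleR add.commute[of x] abs_of_nat)
    ultimately show ?thesis
      using True by (simp del: of_nat_Suc)
  next
    case False
    have "norm (?e /\<^sub>R real (Suc j)) \<le> 1" by (simp add: norm_axis_1 inverse_le_1_iff)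
    moreover have "norm x \<le> norm (?e /\<^sub>R real (Suc j) + x) + norm (?e /\<^sub>R real (Suc j))"
      using norm_triangle_ineq4[of "?e /\<^sub>R real (Suc j) + x" "?e /\<^sub>R real (Suc j)"] by simp
    ultimately have "\<phi> (?e /\<^sub>R real (Suc j) + x) = 0" "\<phi> x = 0"
      using False by (auto intro!: R)
    then show ?thesis using B0 by (simp add: q_def)
  qed
  have "integral\<^sup>L lborel (q j) = 0" for j
  proof -
    have int: "integrable lborel \<phi>" by (rule test_functions_integrable(1)[OF \<phi>])
    have "integrable (distr lborel borel ((+) (?e /\<^sub>R real (Suc j)))) \<phi>"
      using int by (simp add: lborel_distr_plus)
    then have int': "integrable lborel (\<lambda>x. \<phi> (?e /\<^sub>R real (Suc j) + x))"
      by (subst (asm) integrable_distr_eq) auto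
    have "integral\<^sup>L (distr lborel borel ((+) (?e /\<^sub>R real (Suc j)))) \<phi>
        = (\<integral>x. \<phi> (?e /\<^sub>R real (Suc j) + x) \<partial>lborel)"
      by (rule integral_distr) auto
    then have "(\<integral>x. \<phi> (?e /\<^sub>R real (Suc j) + x) \<partial>lborel) = integral\<^sup>L lborel \<phi>"
      by (simp add: lborel_distr_plus)
    then show ?thesis
      unfolding q_def using int int' by simp
  qed
  moreover have "(\<lambda>j. integral\<^sup>L lborel (q j)) \<longlonglongrightarrow> integral\<^sup>L lborel (partial i \<phi>)"
  proof (rule integral_dominated_convergence)
    show "integrable lborel (\<lambda>x. indicator (cball 0 (R + 1)) x *\<^sub>R B)"
      by (rule borel_integrable_compact) auto
    show "q j \<in> borel_measurable lborel" for j unfolding q_def by measurable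
  qed (use lim bound in auto)
  ultimately have "integral\<^sup>L lborel (partial i \<phi>) = 0"
    by (simp add: LIMSEQ_const_iff)
  then show ?thesis by (subst integral_completion) auto
qed

lemma integration_by_parts:
  assumes f: "smooth_on UNIV f" and \<phi>: "\<phi> \<in> test_functions U"
  shows "(\<integral>x. f x * partial i \<phi> x \<partial>lebesgue) = - (\<integral>x. partial i f x * \<phi> x \<partial>lebesgue)"
proof -
  have "(\<integral>x. f x * partial i \<phi> x + partial i f x * \<phi> x \<partial>lebesgue) = 0"
    using integral_partial_test_function[OF test_functions_mult[OF f \<phi>], of i]
    by (simp add: partial_mult smooth_on_imp_differentiable[OF f] test_functionsD(2)[OF \<phi>])
  moreover have "integrable lebesgue (\<lambda>x. f x * partial i \<phi> x)" "integrable lebesgue (\<lambda>x. partial i f x * \<phi> x)"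
    by (intro test_functions_integrable(2)[of _ U] test_functions_mult f \<phi> test_functions_partial
        smooth_on_partial)+
  ultimately show ?thesis by (simp add: eq_neg_iff_add_eq_0)
qed

text \<open>Green's formula without boundary terms; it turns the pointwise Helmholtz equation of the incident
  wave into the distributional one.\<close>

lemma integral_laplacian_symmetric:
  assumes f: "smooth_on UNIV f" and \<phi>: "\<phi> \<in> test_functions U"
  shows "(\<integral>x. f x * laplacian \<phi> x \<partial>lebesgue) = (\<integral>x. laplacian f x * \<phi> x \<partial>lebesgue)"
proof -
  have "(\<integral>x. f x * partial i (partial i \<phi>) x \<partial>lebesgue) = (\<integral>x. partial i (partial i f) x * \<phi> x \<partial>lebesgue)" for i
    by (simp add: integration_by_parts[OF f test_functions_partial[OF \<phi>]]
        integration_by_parts[OF smooth_on_partial[OF f] \<phi>])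
  moreover have "integrable lebesgue (\<lambda>x. f x * partial i (partial i \<phi>) x)"
      "integrable lebesgue (\<lambda>x. partial i (partial i f) x * \<phi> x)" for i
    by (intro test_functions_integrable(2)[of _ U] test_functions_mult f \<phi> test_functions_partial
        smooth_on_partial)+
  ultimately show ?thesis
    by (simp add: laplacian_def sum_distrib_left sum_distrib_right)
qed

section \<open>Square integrable functions\<close>

lemma cmod_lincomb_squared:
  "(cmod (a + c * b))\<^sup>2 \<le> 2 * (cmod a)\<^sup>2 + 2 * (cmod c)\<^sup>2 * (cmod b)\<^sup>2"
proof -
  have "cmod (a + c * b) \<le> cmod a + cmod c * cmod b"
    using norm_triangle_ineq[of a "c * b"] by (simp add: norm_mult)
  then have "(cmod (a + c * b))\<^sup>2 \<le> (cmod a + cmod c * cmod b)\<^sup>2"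
    by (intro power_mono) auto
  moreover have "0 \<le> (cmod a - cmod c * cmod b)\<^sup>2" by simp
  ultimately show ?thesis by (simp add: power2_eq_square algebra_simps)
qed

lemma L2_lincomb:
  assumes "u \<in> L2 M" "v \<in> L2 M"
  shows "(\<lambda>x. u x + c * v x) \<in> L2 M"
proof -
  have [measurable]: "u \<in> borel_measurable M" "v \<in> borel_measurable M"
    using assms by (auto simp: L2_def)
  have "integrable M (\<lambda>x. 2 * (cmod (u x))\<^sup>2 + 2 * (cmod c)\<^sup>2 * (cmod (v x))\<^sup>2)"
    using assms by (auto simp: L2_def)
  then have "integrable M (\<lambda>x. (cmod (u x + c * v x))\<^sup>2)"
    by (rule Bochner_Integration.integrable_bound) (auto simp: cmod_lincomb_squared)
  then show ?thesis by (simp add: L2_def)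
qed

lemma L2_bounded_mult:
  assumes "u \<in> L2 M" "b \<in> borel_measurable M" "\<And>x. cmod (b x) \<le> B"
  shows "(\<lambda>x. b x * u x) \<in> L2 M"
proof -
  have [measurable]: "u \<in> borel_measurable M" "b \<in> borel_measurable M"
    using assms by (auto simp: L2_def)
  have "integrable M (\<lambda>x. B\<^sup>2 * (cmod (u x))\<^sup>2)"
    using assms by (auto simp: L2_def)
  then have "integrable M (\<lambda>x. (cmod (b x * u x))\<^sup>2)"
  proof (rule Bochner_Integration.integrable_bound)
    have "(cmod (b x * u x))\<^sup>2 \<le> B\<^sup>2 * (cmod (u x))\<^sup>2" for x
      using assms(3)[of x] unfolding norm_mult power_mult_distrib
      by (intro mult_right_mono power_mono) auto
    then show "AE x in M. norm ((cmod (b x * u x))\<^sup>2) \<le> norm (B\<^sup>2 * (cmod (u x))\<^sup>2)"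
      by simp
  qed simp
  then show ?thesis by (simp add: L2_def)
qed

lemma L2_mult_integrable:
  assumes "u \<in> L2 M" "v \<in> L2 M"
  shows "integrable M (\<lambda>x. u x * v x)"
proof (rule Bochner_Integration.integrable_bound)
  show "integrable M (\<lambda>x. (cmod (u x))\<^sup>2 + (cmod (v x))\<^sup>2)"
    using assms by (auto simp: L2_def)
  show "(\<lambda>x. u x * v x) \<in> borel_measurable M"
    using assms by (auto simp: L2_def)
  have "cmod (u x) * cmod (v x) \<le> (cmod (u x))\<^sup>2 + (cmod (v x))\<^sup>2" for x
  proof -
    have "2 * cmod (u x) * cmod (v x) \<le> (cmod (u x))\<^sup>2 + (cmod (v x))\<^sup>2"
      by (rule sum_squares_bound)
    moreover have "0 \<le> cmod (u x) * cmod (v x)" by simp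
    ultimately show ?thesis by linarith
  qed
  then show "AE x in M. norm (u x * v x) \<le> norm ((cmod (u x))\<^sup>2 + (cmod (v x))\<^sup>2)"
    by (simp add: norm_mult)
qed

lemma open_sets_lebesgue: "open U \<Longrightarrow> U \<in> sets lebesgue"
  by (simp add: borel_open)

lemma L2_lebesgue_iff:
  assumes "S \<in> sets lebesgue"
  shows "u \<in> L2 (lebesgue_on S) \<longleftrightarrow> (\<lambda>x. if x \<in> S then u x else 0) \<in> L2 lebesgue"
proof -
  have "(\<lambda>x. (cmod (if x \<in> S then u x else 0))\<^sup>2) = (\<lambda>x. if x \<in> S then (cmod (u x))\<^sup>2 else 0)"
    by auto
  then show ?thesis
    by (simp add: L2_def borel_measurable_if[OF assms] Lebesgue_Measure.integrable_restrict_UNIV[OF assms])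
qed

lemma L2_subset:
  assumes "u \<in> L2 (lebesgue_on T)" "S \<subseteq> T" "S \<in> sets lebesgue" "T \<in> sets lebesgue"
  shows "u \<in> L2 (lebesgue_on S)"
proof -
  have "(\<lambda>x. indicator S x * (if x \<in> T then u x else 0)) \<in> L2 lebesgue"
    by (rule L2_bounded_mult[of _ _ _ 1]) (use assms L2_lebesgue_iff in \<open>auto simp: indicator_def\<close>)
  also have "(\<lambda>x. indicator S x * (if x \<in> T then u x else 0)) = (\<lambda>x. if x \<in> S then u x else 0)"
    using assms(2) by (intro ext) (auto simp: indicator_def)
  finally show ?thesis using L2_lebesgue_iff[OF assms(3)] by blast
qed

lemma L2_zero_extension:
  assumes "u \<in> L2 (lebesgue_on S)" "S \<in> sets lebesgue" "T \<in> sets lebesgue" "S \<subseteq> T"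
  shows "(\<lambda>x. if x \<in> S then u x else 0) \<in> L2 (lebesgue_on T)"
  using L2_subset[of _ UNIV T] assms L2_lebesgue_iff[OF assms(2)] by (simp add: lebesgue_on_UNIV_eq)

lemma L2_Un_disjoint:
  assumes "u \<in> L2 (lebesgue_on S)" "u \<in> L2 (lebesgue_on T)" "S \<inter> T = {}"
    "S \<in> sets lebesgue" "T \<in> sets lebesgue"
  shows "u \<in> L2 (lebesgue_on (S \<union> T))"
proof -
  have "(\<lambda>x. (if x \<in> S then u x else 0) + 1 * (if x \<in> T then u x else 0)) \<in> L2 lebesgue"
    by (rule L2_lincomb) (use assms L2_lebesgue_iff in blast)+
  also have "(\<lambda>x. (if x \<in> S then u x else 0) + 1 * (if x \<in> T then u x else 0))
      = (\<lambda>x. if x \<in> S \<union> T then u x else 0)"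
    using assms(3) by (intro ext) auto
  finally show ?thesis using L2_lebesgue_iff assms(4,5) by blast
qed

lemma test_functions_L2:
  assumes \<phi>: "\<phi> \<in> test_functions V" and U: "U \<in> sets lebesgue"
  shows "\<phi> \<in> L2 (lebesgue_on U)"
proof -
  have "continuous_on UNIV \<phi>" by (rule test_functionsD(3)[OF \<phi>])
  then have m: "\<phi> \<in> borel_measurable borel" by (rule borel_measurable_continuous_onI)
  have "integrable lborel (\<lambda>x. (cmod (\<phi> x))\<^sup>2)"
  proof (rule integrable_compact_support)
    show "continuous_on UNIV (\<lambda>x. (cmod (\<phi> x))\<^sup>2)"
      by (intro continuous_intros test_functionsD(3)[OF \<phi>])
    show "compact (closure {x. \<phi> x \<noteq> 0})" using \<phi> by (simp add: test_functions_def)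
    show "(cmod (\<phi> x))\<^sup>2 = 0" if "x \<notin> closure {x. \<phi> x \<noteq> 0}" for x
      by (simp only: zero_outside_support[OF that]) simp
  qed
  then have "integrable lebesgue (\<lambda>x. (cmod (\<phi> x))\<^sup>2)"
    using m by (subst integrable_completion) auto
  then have "\<phi> \<in> L2 (lebesgue_on UNIV)"
    using m by (simp add: L2_def lebesgue_on_UNIV_eq measurable_completion)
  then show ?thesis by (rule L2_subset) (use U in auto)
qed

text \<open>This integrability is what allows weak formulations to be split into sums: without it the
  Bochner integral would silently be \<open>0\<close>.\<close>

lemma L2_test_function_integrable:
  assumes "u \<in> L2 (lebesgue_on U)" "\<phi> \<in> test_functions V" "U \<in> sets lebesgue"
  shows "integrable (lebesgue_on U) (\<lambda>x. u x * \<phi> x)"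
  by (rule L2_mult_integrable[OF assms(1) test_functions_L2[OF assms(2,3)]])

lemma integral_lebesgue_on_subset:
  fixes f :: "real ^ 'm \<Rightarrow> complex"
  assumes "U \<subseteq> V" "U \<in> sets lebesgue" "V \<in> sets lebesgue" "\<And>x. x \<notin> U \<Longrightarrow> f x = 0"
  shows "integral\<^sup>L (lebesgue_on V) f = integral\<^sup>L (lebesgue_on U) f"
proof -
  have "integral\<^sup>L (lebesgue_on V) f = integral\<^sup>L (lebesgue_on V) (\<lambda>x. if x \<in> U then f x else 0)"
    by (rule Bochner_Integration.integral_cong) (use assms(4) in auto)
  then show ?thesis using Lebesgue_Measure.integral_restrict[OF assms(1-3)] by simp
qed

lemma L2_tendsto_lincomb:
  assumes "L2_tendsto M \<phi> u" "L2_tendsto M \<psi> v"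
    and [measurable]: "\<And>j. \<phi> j \<in> borel_measurable M" "\<And>j. \<psi> j \<in> borel_measurable M"
      "u \<in> borel_measurable M" "v \<in> borel_measurable M"
  shows "L2_tendsto M (\<lambda>j x. \<phi> j x + c * \<psi> j x) (\<lambda>x. u x + c * v x)"
  unfolding L2_tendsto_def
proof (rule tendsto_sandwich[OF _ _ tendsto_const])
  let ?I = "\<lambda>\<phi> u j. \<integral>\<^sup>+x. ennreal ((cmod (\<phi> j x - u x))\<^sup>2) \<partial>M"
  show "\<forall>\<^sub>F j in sequentially. ?I (\<lambda>j x. \<phi> j x + c * \<psi> j x) (\<lambda>x. u x + c * v x) j
      \<le> ennreal 2 * ?I \<phi> u j + ennreal (2 * (cmod c)\<^sup>2) * ?I \<psi> v j"
  proof (rule always_eventually, rule allI)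
    fix j
    have "ennreal ((cmod (\<phi> j x + c * \<psi> j x - (u x + c * v x)))\<^sup>2)
        \<le> ennreal 2 * ennreal ((cmod (\<phi> j x - u x))\<^sup>2)
          + ennreal (2 * (cmod c)\<^sup>2) * ennreal ((cmod (\<psi> j x - v x))\<^sup>2)" for x
    proof -
      have "\<phi> j x + c * \<psi> j x - (u x + c * v x) = (\<phi> j x - u x) + c * (\<psi> j x - v x)"
        by (simp add: algebra_simps)
      then have "ennreal ((cmod (\<phi> j x + c * \<psi> j x - (u x + c * v x)))\<^sup>2)
          \<le> ennreal (2 * (cmod (\<phi> j x - u x))\<^sup>2 + 2 * (cmod c)\<^sup>2 * (cmod (\<psi> j x - v x))\<^sup>2)"
        using cmod_lincomb_squared by (simp only: ennreal_leI)
      then show ?thesis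
        by (simp only: ennreal_plus ennreal_mult zero_le_power2 mult_nonneg_nonneg zero_le_numeral)
    qed
    then have "?I (\<lambda>j x. \<phi> j x + c * \<psi> j x) (\<lambda>x. u x + c * v x) j
       \<le> (\<integral>\<^sup>+x. (ennreal 2 * ennreal ((cmod (\<phi> j x - u x))\<^sup>2)
          + ennreal (2 * (cmod c)\<^sup>2) * ennreal ((cmod (\<psi> j x - v x))\<^sup>2)) \<partial>M)"
      by (intro nn_integral_mono)
    also have "\<dots> = ennreal 2 * ?I \<phi> u j + ennreal (2 * (cmod c)\<^sup>2) * ?I \<psi> v j"
      by (simp add: nn_integral_add nn_integral_cmult)
    finally show "?I (\<lambda>j x. \<phi> j x + c * \<psi> j x) (\<lambda>x. u x + c * v x) j
      \<le> ennreal 2 * ?I \<phi> u j + ennreal (2 * (cmod c)\<^sup>2) * ?I \<psi> v j" .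
  qed
  have "(\<lambda>j. ennreal 2 * ?I \<phi> u j + ennreal (2 * (cmod c)\<^sup>2) * ?I \<psi> v j)
      \<longlonglongrightarrow> ennreal 2 * 0 + ennreal (2 * (cmod c)\<^sup>2) * 0"
    using assms(1,2) unfolding L2_tendsto_def
    by (intro tendsto_add ennreal_tendsto_cmult) auto
  then show "(\<lambda>j. ennreal 2 * ?I \<phi> u j + ennreal (2 * (cmod c)\<^sup>2) * ?I \<psi> v j) \<longlonglongrightarrow> 0"
    by simp
qed auto

lemma L2_tendsto_subset:
  assumes "L2_tendsto (lebesgue_on T) \<phi> u" "S \<subseteq> T" "S \<in> sets lebesgue" "T \<in> sets lebesgue"
  shows "L2_tendsto (lebesgue_on S) \<phi> u"
  unfolding L2_tendsto_def
proof (rule tendsto_sandwich[OF _ _ tendsto_const assms(1)[unfolded L2_tendsto_def]])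
  show "\<forall>\<^sub>F j in sequentially. (\<integral>\<^sup>+x. ennreal ((cmod (\<phi> j x - u x))\<^sup>2) \<partial>lebesgue_on S)
      \<le> (\<integral>\<^sup>+x. ennreal ((cmod (\<phi> j x - u x))\<^sup>2) \<partial>lebesgue_on T)"
    using assms(2-4)
    by (auto simp: nn_integral_restrict_space intro!: always_eventually nn_integral_mono split: split_indicator)
qed auto

section \<open>Weak derivatives and the Helmholtz equation\<close>

lemma weak_partial_lincomb:
  assumes U: "U \<in> sets lebesgue"
    and L2: "u \<in> L2 (lebesgue_on U)" "g \<in> L2 (lebesgue_on U)" "v \<in> L2 (lebesgue_on U)" "h \<in> L2 (lebesgue_on U)"
    and "weak_partial U i u g" "weak_partial U i v h"
  shows "weak_partial U i (\<lambda>x. u x + c * v x) (\<lambda>x. g x + c * h x)"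
  unfolding weak_partial_def
proof
  fix \<phi> assume \<phi>: "\<phi> \<in> test_functions U"
  note int = L2_test_function_integrable[OF _ \<phi> U] L2_test_function_integrable[OF _ test_functions_partial[OF \<phi>] U]
  show "(\<integral>x. (u x + c * v x) * partial i \<phi> x \<partial>lebesgue_on U) = - (\<integral>x. (g x + c * h x) * \<phi> x \<partial>lebesgue_on U)"
    using assms(6,7) \<phi> int[OF L2(1)] int[OF L2(2)] int[OF L2(3)] int[OF L2(4)]
    by (simp add: weak_partial_def distrib_right mult.assoc)
qed

lemma weak_partial_subset:
  assumes "weak_partial V i u g" "U \<subseteq> V" "U \<in> sets lebesgue" "V \<in> sets lebesgue"
  shows "weak_partial U i u g"
  unfolding weak_partial_def
proof
  fix \<phi> assume \<phi>: "\<phi> \<in> test_functions U"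
  then have "\<phi> \<in> test_functions V" using assms(2) by (rule test_functions_mono)
  then show "(\<integral>x. u x * partial i \<phi> x \<partial>lebesgue_on U) = - (\<integral>x. g x * \<phi> x \<partial>lebesgue_on U)"
    using assms(1)
    by (simp add: weak_partial_def integral_lebesgue_on_subset[OF assms(2-4), symmetric]
       test_functionsD(4)[OF \<phi>] test_functionsD(4)[OF test_functions_partial[OF \<phi>]])
qed

lemma weak_partial_AE_cong:
  assumes "weak_partial U i u g" "AE x in lebesgue_on U. v x = u x"
    "u \<in> L2 (lebesgue_on U)" "v \<in> L2 (lebesgue_on U)" "U \<in> sets lebesgue"
  shows "weak_partial U i v g"
  unfolding weak_partial_def
proof
  fix \<phi> assume \<phi>: "\<phi> \<in> test_functions U"
  have "(\<integral>x. v x * partial i \<phi> x \<partial>lebesgue_on U) = (\<integral>x. u x * partial i \<phi> x \<partial>lebesgue_on U)"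
    using assms(2) L2_test_function_integrable[OF _ test_functions_partial[OF \<phi>]] assms(3-5)
    by (intro integral_cong_AE) (auto simp: borel_measurable_integrable)
  then show "(\<integral>x. v x * partial i \<phi> x \<partial>lebesgue_on U) = - (\<integral>x. g x * \<phi> x \<partial>lebesgue_on U)"
    using assms(1) \<phi> by (simp add: weak_partial_def)
qed

lemma H1D: "u \<in> H1 U \<Longrightarrow> u \<in> L2 (lebesgue_on U)"
  by (simp add: H1_def)

lemma H1_lincomb:
  assumes "u \<in> H1 U" "v \<in> H1 U" "U \<in> sets lebesgue"
  shows "(\<lambda>x. u x + c * v x) \<in> H1 U"
proof -
  have "\<exists>g\<in>L2 (lebesgue_on U). weak_partial U i (\<lambda>x. u x + c * v x) g" for i
  proof -
    obtain g h where "g \<in> L2 (lebesgue_on U)" "weak_partial U i u g"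
        "h \<in> L2 (lebesgue_on U)" "weak_partial U i v h"
      using assms(1,2) unfolding H1_def by blast
    then show ?thesis
      using assms H1D
      by (intro bexI[of _ "\<lambda>x. g x + c * h x"] weak_partial_lincomb L2_lincomb) auto
  qed
  then show ?thesis using L2_lincomb[OF assms(1,2)[THEN H1D]] by (simp add: H1_def)
qed

lemma H1_subset:
  assumes "u \<in> H1 V" "U \<subseteq> V" "U \<in> sets lebesgue" "V \<in> sets lebesgue"
  shows "u \<in> H1 U"
  using L2_subset[OF _ assms(2-4)] weak_partial_subset[OF _ assms(2-4)] assms(1)
  unfolding H1_def by blast

lemma helmholtz_test_function:
  "\<phi> \<in> test_functions U \<Longrightarrow> (\<lambda>x. laplacian \<phi> x + of_real (k\<^sup>2 * 1\<^sup>2) * \<phi> x) \<in> test_functions U"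
  by (intro test_functions_add test_functions_laplacian test_functions_cmult)

lemma helmholtz_lincomb:
  assumes "helmholtz k (\<lambda>_. 1) U u" "helmholtz k (\<lambda>_. 1) U v" 
    "u \<in> L2 (lebesgue_on U)" "v \<in> L2 (lebesgue_on U)" "U \<in> sets lebesgue"
  shows "helmholtz k (\<lambda>_. 1) U (\<lambda>x. u x + c * v x)"
  unfolding helmholtz_def
proof
  fix \<phi> assume \<phi>: "\<phi> \<in> test_functions U"
  let ?\<psi> = "\<lambda>x. laplacian \<phi> x + of_real (k\<^sup>2 * 1\<^sup>2) * \<phi> x"
  note int = L2_test_function_integrable[OF _ helmholtz_test_function[OF \<phi>, of k] assms(5)]
  have "(\<integral>x. (u x + c * v x) * ?\<psi> x \<partial>lebesgue_on U) = (\<integral>x. u x * ?\<psi> x + c * (v x * ?\<psi> x) \<partial>lebesgue_on U)"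
    by (simp add: algebra_simps)
  also have "\<dots> = (\<integral>x. u x * ?\<psi> x \<partial>lebesgue_on U) + c * (\<integral>x. v x * ?\<psi> x \<partial>lebesgue_on U)"
    using int[OF assms(3)] int[OF assms(4)] by (subst Bochner_Integration.integral_add) auto
  finally show "(\<integral>x. (u x + c * v x) * ?\<psi> x \<partial>lebesgue_on U) = 0"
    using assms(1,2) \<phi> by (simp only: helmholtz_def) simp
qed

lemma helmholtz_subset:
  assumes "helmholtz k n V u" "U \<subseteq> V" "U \<in> sets lebesgue" "V \<in> sets lebesgue"
  shows "helmholtz k n U u"
  unfolding helmholtz_def
proof
  fix \<phi> assume \<phi>: "\<phi> \<in> test_functions U"
  then have "\<phi> \<in> test_functions V" using assms(2) by (rule test_functions_mono)
  then show "(\<integral>x. u x * (laplacian \<phi> x + of_real (k\<^sup>2 * (n x)\<^sup>2) * \<phi> x) \<partial>lebesgue_on U) = 0"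
    using assms(1)
    by (simp add: helmholtz_def integral_lebesgue_on_subset[OF assms(2-4), symmetric]
       test_functionsD(4)[OF \<phi>] test_functionsD(4)[OF test_functions_laplacian[OF \<phi>]])
qed

lemma helmholtz_cong:
  assumes "helmholtz k n U u" "\<And>x. x \<in> U \<Longrightarrow> n x = n' x" "\<And>x. x \<in> U \<Longrightarrow> u x = v x" "U \<in> sets lebesgue"
  shows "helmholtz k n' U v"
  unfolding helmholtz_def
proof
  fix \<phi> assume "\<phi> \<in> test_functions U"
  have "(\<integral>x. v x * (laplacian \<phi> x + of_real (k\<^sup>2 * (n' x)\<^sup>2) * \<phi> x) \<partial>lebesgue_on U)
      = (\<integral>x. u x * (laplacian \<phi> x + of_real (k\<^sup>2 * (n x)\<^sup>2) * \<phi> x) \<partial>lebesgue_on U)"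
    by (rule Bochner_Integration.integral_cong) (use assms(2,3) in auto)
  then show "(\<integral>x. v x * (laplacian \<phi> x + of_real (k\<^sup>2 * (n' x)\<^sup>2) * \<phi> x) \<partial>lebesgue_on U) = 0"
    using assms(1) \<open>\<phi> \<in> _\<close> by (simp add: helmholtz_def)
qed

lemma helmholtz_AE_cong:
  assumes "helmholtz k (\<lambda>_. 1) U u" "AE x in lebesgue_on U. v x = u x"
    "u \<in> borel_measurable (lebesgue_on U)" "v \<in> borel_measurable (lebesgue_on U)" "U \<in> sets lebesgue"
  shows "helmholtz k (\<lambda>_. 1) U v"
  unfolding helmholtz_def
proof
  fix \<phi> assume \<phi>: "\<phi> \<in> test_functions U"
  let ?\<psi> = "\<lambda>x. laplacian \<phi> x + of_real (k\<^sup>2 * 1\<^sup>2) * \<phi> x"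
  have "?\<psi> \<in> borel_measurable (lebesgue_on U)"
    using test_functions_L2[OF helmholtz_test_function[OF \<phi>] assms(5)] by (simp add: L2_def)
  then have "(\<integral>x. v x * ?\<psi> x \<partial>lebesgue_on U) = (\<integral>x. u x * ?\<psi> x \<partial>lebesgue_on U)"
    using assms(2-4) by (intro integral_cong_AE) auto
  then show "(\<integral>x. v x * ?\<psi> x \<partial>lebesgue_on U) = 0"
    using assms(1) \<phi> by (simp only: helmholtz_def)
qed

lemma incident_wave_helmholtz:
  assumes "incident_wave k u" and U: "U \<in> sets lebesgue"
  shows "helmholtz k (\<lambda>_. 1) U u"
  unfolding helmholtz_def
proof
  fix \<phi> assume \<phi>: "\<phi> \<in> test_functions U"
  have u: "smooth_on UNIV u" and eq: "\<And>x. laplacian u x = - ((of_real k)\<^sup>2 * u x)"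
    using assms by (auto simp: incident_wave_def eq_neg_iff_add_eq_0)
  let ?f = "\<lambda>x. u x * (laplacian \<phi> x + of_real (k\<^sup>2 * 1\<^sup>2) * \<phi> x)"
  have int: "integrable lebesgue (\<lambda>x. u x * laplacian \<phi> x)" "integrable lebesgue (\<lambda>x. u x * \<phi> x)"
    by (intro test_functions_integrable(2)[of _ U] test_functions_mult u \<phi> test_functions_laplacian)+
  have "integral\<^sup>L (lebesgue_on U) ?f = integral\<^sup>L (lebesgue_on UNIV) ?f"
    by (rule integral_lebesgue_on_subset[symmetric])
       (use U in \<open>auto simp: test_functionsD(4)[OF \<phi>] test_functionsD(4)[OF test_functions_laplacian[OF \<phi>]]\<close>)
  also have "\<dots> = (\<integral>x. u x * laplacian \<phi> x + (of_real k)\<^sup>2 * (u x * \<phi> x) \<partial>lebesgue)"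
    by (simp add: lebesgue_on_UNIV_eq algebra_simps)
  also have "\<dots> = 0"
    using int integral_laplacian_symmetric[OF u \<phi>] by (simp add: eq mult.assoc)
  finally show "integral\<^sup>L (lebesgue_on U) ?f = 0" .
qed

section \<open>Traces\<close>

lemma H1_tendsto_lincomb:
  assumes u: "H1_tendsto U \<phi> u" and v: "H1_tendsto U \<psi> v" and U: "U \<in> sets lebesgue"
    and \<phi>: "\<And>j. \<phi> j \<in> test_functions UNIV" and \<psi>: "\<And>j. \<psi> j \<in> test_functions UNIV"
  shows "H1_tendsto U (\<lambda>j x. \<phi> j x + c * \<psi> j x) (\<lambda>x. u x + c * v x)"
  unfolding H1_tendsto_def
proof (intro conjI allI)
  have meas: "f \<in> borel_measurable (lebesgue_on U)" if "f \<in> test_functions UNIV" for f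
    using test_functions_L2[OF that U] by (simp add: L2_def)
  have L2: "u \<in> L2 (lebesgue_on U)" "v \<in> L2 (lebesgue_on U)" using u v by (auto simp: H1_tendsto_def)
  then show "(\<lambda>x. u x + c * v x) \<in> L2 (lebesgue_on U)" by (rule L2_lincomb)
  show "L2_tendsto (lebesgue_on U) (\<lambda>j x. \<phi> j x + c * \<psi> j x) (\<lambda>x. u x + c * v x)"
    using u v L2 meas[OF \<phi>] meas[OF \<psi>]
    by (intro L2_tendsto_lincomb) (simp_all add: H1_tendsto_def L2_def)
  fix i
  obtain g h where g: "g \<in> L2 (lebesgue_on U)" "weak_partial U i u g"
      "L2_tendsto (lebesgue_on U) (\<lambda>j. partial i (\<phi> j)) g"
    and h: "h \<in> L2 (lebesgue_on U)" "weak_partial U i v h"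
      "L2_tendsto (lebesgue_on U) (\<lambda>j. partial i (\<psi> j)) h"
    using u v unfolding H1_tendsto_def by blast
  have "partial i (\<lambda>x. \<phi> j x + c * \<psi> j x) = (\<lambda>x. partial i (\<phi> j) x + c * partial i (\<psi> j) x)" for j
    using partial_add[OF test_functionsD(2)[OF \<phi>] test_functionsD(2)[OF test_functions_cmult[OF \<psi>]]]
      partial_linear[OF bounded_linear_mult_right test_functionsD(2)[OF \<psi>]] by simp
  moreover have "L2_tendsto (lebesgue_on U) (\<lambda>j x. partial i (\<phi> j) x + c * partial i (\<psi> j) x) (\<lambda>x. g x + c * h x)"
    using g h meas[OF test_functions_partial[OF \<phi>]] meas[OF test_functions_partial[OF \<psi>]]
    by (intro L2_tendsto_lincomb) (simp_all add: L2_def)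
  ultimately show "\<exists>g\<in>L2 (lebesgue_on U). weak_partial U i (\<lambda>x. u x + c * v x) g \<and>
      L2_tendsto (lebesgue_on U) (\<lambda>j. partial i (\<lambda>x. \<phi> j x + c * \<psi> j x)) g"
    using g h L2 U by (intro bexI[of _ "\<lambda>x. g x + c * h x"]) (auto intro: L2_lincomb weak_partial_lincomb)
qed

lemma H1_tendsto_subset:
  assumes "H1_tendsto V \<phi> u" "U \<subseteq> V" "U \<in> sets lebesgue" "V \<in> sets lebesgue"
  shows "H1_tendsto U \<phi> u"
  using L2_subset[OF _ assms(2-4)] L2_tendsto_subset[OF _ assms(2-4)]
    weak_partial_subset[OF _ assms(2-4)] assms(1)
  unfolding H1_tendsto_def by blast

lemma continuous_measurable_surface_measure:
  fixes \<phi> :: "real ^ 'm \<Rightarrow> complex"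
  assumes "continuous_on UNIV \<phi>"
  shows "\<phi> \<in> borel_measurable (surface_measure S)"
proof -
  have "sets (hausdorff_measure (CARD('m) - 1) :: (real ^ 'm) measure) = sets borel"
    unfolding hausdorff_measure_def by (metis sets.sigma_sets_eq sets_measure_of space_borel top_greatest Pow_UNIV)
  then have "\<phi> \<in> borel_measurable (hausdorff_measure (CARD('m) - 1))"
    using borel_measurable_continuous_onI[OF assms] by (simp cong: measurable_cong_sets)
  then show ?thesis
    unfolding surface_measure_def by (intro measurable_completion measurable_restrict_space1)
qed

text \<open>Traces are limits of restrictions of test functions, and the combined approximating sequences
  approximate the combined function both in \<open>H\<^sup>1\<close> and on \<open>S\<close>.\<close>

lemma has_trace_lincomb:
  assumes u: "has_trace U S u f" and v: "has_trace U S v g" and U: "open U"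
  shows "has_trace U S (\<lambda>x. u x + c * v x) (\<lambda>x. f x + c * g x)"
proof -
  obtain \<phi> \<psi> where \<phi>: "\<And>j. \<phi> j \<in> test_functions UNIV" "\<And>R. H1_tendsto (U \<inter> ball 0 R) \<phi> u"
      "L2_tendsto (surface_measure S) \<phi> f"
    and \<psi>: "\<And>j. \<psi> j \<in> test_functions UNIV" "\<And>R. H1_tendsto (U \<inter> ball 0 R) \<psi> v"
      "L2_tendsto (surface_measure S) \<psi> g"
    using u v unfolding has_trace_def by blast
  have L2: "f \<in> L2 (surface_measure S)" "g \<in> L2 (surface_measure S)"
    using u v by (auto simp: has_trace_def)
  have meas: "h \<in> borel_measurable (surface_measure S)" if "h \<in> test_functions UNIV" for h
    by (rule continuous_measurable_surface_measure[OF test_functionsD(3)[OF that]])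
  show ?thesis
    unfolding has_trace_def
  proof (intro conjI exI[of _ "\<lambda>j x. \<phi> j x + c * \<psi> j x"] allI)
    show "(\<lambda>x. f x + c * g x) \<in> L2 (surface_measure S)" by (rule L2_lincomb[OF L2])
    show "(\<lambda>x. \<phi> j x + c * \<psi> j x) \<in> test_functions UNIV" for j
      by (intro test_functions_add test_functions_cmult \<phi>(1) \<psi>(1))
    show "H1_tendsto (U \<inter> ball 0 R) (\<lambda>j x. \<phi> j x + c * \<psi> j x) (\<lambda>x. u x + c * v x)" for R
      using U by (intro H1_tendsto_lincomb \<phi> \<psi> open_sets_lebesgue) auto
    show "L2_tendsto (surface_measure S) (\<lambda>j x. \<phi> j x + c * \<psi> j x) (\<lambda>x. f x + c * g x)"
      using L2 \<phi>(3) \<psi>(3) meas[OF \<phi>(1)] meas[OF \<psi>(1)]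
      by (intro L2_tendsto_lincomb) (simp_all add: L2_def)
  qed
qed

lemma has_trace_subset:
  assumes "has_trace V S u f" "U \<subseteq> V" "open U" "open V"
  shows "has_trace U S u f"
proof -
  have "H1_tendsto (U \<inter> ball 0 R) \<phi> u" if "H1_tendsto (V \<inter> ball 0 R) \<phi> u" for R \<phi>
    using that by (rule H1_tendsto_subset) (use assms(2-4) in \<open>auto intro!: open_sets_lebesgue\<close>)
  then show ?thesis using assms(1) unfolding has_trace_def by blast
qed

lemma has_trace_AE_cong:
  assumes "has_trace U S u f" "AE x in surface_measure S. f x = g x" "g \<in> L2 (surface_measure S)"
  shows "has_trace U S u g"
proof -
  have "L2_tendsto (surface_measure S) \<phi> g" if "L2_tendsto (surface_measure S) \<phi> f" for \<phi>
  proof -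
    have "(\<integral>\<^sup>+x. ennreal ((cmod (\<phi> j x - f x))\<^sup>2) \<partial>surface_measure S)
        = (\<integral>\<^sup>+x. ennreal ((cmod (\<phi> j x - g x))\<^sup>2) \<partial>surface_measure S)" for j
      by (rule nn_integral_cong_AE) (use assms(2) in auto)
    then show ?thesis using that by (simp add: L2_tendsto_def)
  qed
  then show ?thesis using assms unfolding has_trace_def by blast
qed

text \<open>Having a trace entails local \<open>H\<^sup>1\<close> regularity, because the approximating sequence converges in
  \<open>H\<^sup>1\<close>. For the incident wave, whose traces are given, this yields its \<open>H\<^sup>1\<close> bounds on balls.\<close>

lemma has_trace_H1:
  assumes "has_trace U S u f"
  shows "u \<in> H1 (U \<inter> ball 0 R)"
  using assms unfolding has_trace_def H1_tendsto_def H1_def by blast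

section \<open>Gluing local solutions\<close>

lemma L2_cong:
  assumes "u \<in> L2 (lebesgue_on S)" "\<And>x. x \<in> S \<Longrightarrow> v x = u x"
  shows "v \<in> L2 (lebesgue_on S)"
proof -
  have "v \<in> borel_measurable (lebesgue_on S) \<longleftrightarrow> u \<in> borel_measurable (lebesgue_on S)"
    by (rule measurable_cong) (use assms(2) in simp)
  moreover have "integrable (lebesgue_on S) (\<lambda>x. (cmod (v x))\<^sup>2) \<longleftrightarrow> integrable (lebesgue_on S) (\<lambda>x. (cmod (u x))\<^sup>2)"
    by (rule Bochner_Integration.integrable_cong) (use assms(2) in simp_all)
  ultimately show ?thesis using assms(1) by (simp add: L2_def)
qed

lemma H1_AE_cong:
  assumes "u \<in> H1 U" "AE x in lebesgue_on U. v x = u x" "v \<in> L2 (lebesgue_on U)" "U \<in> sets lebesgue"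
  shows "v \<in> H1 U"
  using weak_partial_AE_cong[OF _ assms(2) H1D[OF assms(1)] assms(3,4)] assms(1,3)
  unfolding H1_def by blast

text \<open>\<open>\<theta>\<close> and \<open>1 - \<theta>\<close> form a partition of unity for the cover of the space by \<open>U\<close> and \<open>V\<close>. The set
  \<open>B\<close>, a ball in the application, is where the glued function is considered: square integrability
  is available only on bounded sets.\<close>

locale cutoff =
  fixes U V B :: "(real ^ 'm) set" and \<theta> :: "real ^ 'm \<Rightarrow> complex"
  assumes open_sets: "open U" "open V" "open B"
    and smooth: "smooth_on UNIV \<theta>"
    and bounded: "\<And>x. cmod (\<theta> x) \<le> 1"
    and support: "closure {x. \<theta> x \<noteq> 0} \<subseteq> U" "closure {x. 1 - \<theta> x \<noteq> 0} \<subseteq> V"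
begin

lemma lebesgue_sets: "U \<inter> B \<in> sets lebesgue" "V \<inter> B \<in> sets lebesgue" "B \<in> sets lebesgue"
  using open_sets by (auto intro!: open_sets_lebesgue)

lemma split_test_function:
  assumes "\<phi> \<in> test_functions B"
  shows "(\<lambda>x. \<theta> x * \<phi> x) \<in> test_functions (U \<inter> B)"
    "(\<lambda>x. (1 - \<theta> x) * \<phi> x) \<in> test_functions (V \<inter> B)"
    "\<phi> = (\<lambda>x. \<theta> x * \<phi> x + (1 - \<theta> x) * \<phi> x)"
proof -
  show "(\<lambda>x. \<theta> x * \<phi> x) \<in> test_functions (U \<inter> B)"
    by (rule test_functions_mult_Int[OF smooth support(1) assms])
  show "(\<lambda>x. (1 - \<theta> x) * \<phi> x) \<in> test_functions (V \<inter> B)"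
    by (rule test_functions_mult_Int[OF smooth_diff[OF smooth_const smooth] support(2) assms])
qed (simp add: algebra_simps)

text \<open>The weak derivative is taken to be \<open>\<theta> g\<^sub>U + (1 - \<theta>) g\<^sub>V\<close>. Since every test function \<open>\<phi>\<close> is the sum
  of \<open>\<theta> \<phi>\<close>, supported in \<open>U\<close>, and \<open>(1 - \<theta>) \<phi>\<close>, supported in \<open>V\<close>, this combination is correct whether
  or not \<open>g\<^sub>U\<close> and \<open>g\<^sub>V\<close> agree on the overlap.\<close>

lemma H1_glue:
  assumes u: "u \<in> L2 (lebesgue_on B)" "u \<in> H1 (U \<inter> B)" "u \<in> H1 (V \<inter> B)"
  shows "u \<in> H1 B"
proof -
  have "\<exists>g\<in>L2 (lebesgue_on B). weak_partial B i u g" for i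
  proof -
    obtain gU gV where gU: "gU \<in> L2 (lebesgue_on (U \<inter> B))" "weak_partial (U \<inter> B) i u gU"
      and gV: "gV \<in> L2 (lebesgue_on (V \<inter> B))" "weak_partial (V \<inter> B) i u gV"
      using u(2,3) unfolding H1_def by blast
    define GU where "GU x = (if x \<in> U \<inter> B then gU x else 0)" for x
    define GV where "GV x = (if x \<in> V \<inter> B then gV x else 0)" for x
    have GU: "GU \<in> L2 (lebesgue_on B)"
      unfolding GU_def[abs_def] by (rule L2_zero_extension[OF gU(1) lebesgue_sets(1,3)]) simp
    have GV: "GV \<in> L2 (lebesgue_on B)"
      unfolding GV_def[abs_def] by (rule L2_zero_extension[OF gV(1) lebesgue_sets(2,3)]) simp
    \<comment> \<open>the factor \<open>1\<close> gives the sum the shape of the lemma on linear combinations\<close>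
    define g where "g x = \<theta> x * GU x + 1 * ((1 - \<theta> x) * GV x)" for x
    have meas: "\<theta> \<in> borel_measurable (lebesgue_on B)"
      by (intro continuous_imp_measurable_on_sets_lebesgue smooth_on_imp_continuous smooth lebesgue_sets)
    have "cmod (1 - \<theta> x) \<le> 2" for x
      using norm_triangle_ineq4[of 1 "\<theta> x"] bounded[of x] by simp
    then have "g \<in> L2 (lebesgue_on B)"
      unfolding g_def[abs_def] using GU GV meas bounded
      by (intro L2_lincomb L2_bounded_mult) auto
    moreover have "weak_partial B i u g"
      unfolding weak_partial_def
    proof
      fix \<phi> assume "\<phi> \<in> test_functions B"
      note \<phi> = split_test_function[OF this]
      let ?a = "\<lambda>x. \<theta> x * \<phi> x" and ?b = "\<lambda>x. (1 - \<theta> x) * \<phi> x"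
      note int = L2_test_function_integrable[OF _ _ lebesgue_sets(3)]
      note a = integral_lebesgue_on_subset[OF _ lebesgue_sets(1) lebesgue_sets(3)]
      note b = integral_lebesgue_on_subset[OF _ lebesgue_sets(2) lebesgue_sets(3)]
      have "partial i \<phi> = (\<lambda>x. partial i ?a x + partial i ?b x)"
        using partial_add[OF test_functionsD(2)[OF \<phi>(1)] test_functionsD(2)[OF \<phi>(2)]] \<phi>(3) by metis
      then have "(\<integral>x. u x * partial i \<phi> x \<partial>lebesgue_on B)
          = (\<integral>x. u x * partial i ?a x + u x * partial i ?b x \<partial>lebesgue_on B)"
        by (simp add: distrib_left)
      also have "\<dots> = (\<integral>x. u x * partial i ?a x \<partial>lebesgue_on B) + (\<integral>x. u x * partial i ?b x \<partial>lebesgue_on B)"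
        by (intro Bochner_Integration.integral_add int[OF u(1) test_functions_partial[OF \<phi>(1)]]
            int[OF u(1) test_functions_partial[OF \<phi>(2)]])
      also have "(\<integral>x. u x * partial i ?a x \<partial>lebesgue_on B) = (\<integral>x. u x * partial i ?a x \<partial>lebesgue_on (U \<inter> B))"
        by (rule a) (use test_functionsD(4)[OF test_functions_partial[OF \<phi>(1)]] in auto)
      also have "\<dots> = - (\<integral>x. gU x * ?a x \<partial>lebesgue_on (U \<inter> B))"
        using gU(2) \<phi>(1) by (simp add: weak_partial_def)
      also have "(\<integral>x. gU x * ?a x \<partial>lebesgue_on (U \<inter> B)) = (\<integral>x. GU x * ?a x \<partial>lebesgue_on (U \<inter> B))"
        by (rule Bochner_Integration.integral_cong) (auto simp: GU_def)
      also have "\<dots> = (\<integral>x. GU x * ?a x \<partial>lebesgue_on B)"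
        by (rule a[symmetric]) (auto simp: GU_def)
      also have "(\<integral>x. u x * partial i ?b x \<partial>lebesgue_on B) = (\<integral>x. u x * partial i ?b x \<partial>lebesgue_on (V \<inter> B))"
        by (rule b) (use test_functionsD(4)[OF test_functions_partial[OF \<phi>(2)]] in auto)
      also have "\<dots> = - (\<integral>x. gV x * ?b x \<partial>lebesgue_on (V \<inter> B))"
        using gV(2) \<phi>(2) by (simp add: weak_partial_def)
      also have "(\<integral>x. gV x * ?b x \<partial>lebesgue_on (V \<inter> B)) = (\<integral>x. GV x * ?b x \<partial>lebesgue_on (V \<inter> B))"
        by (rule Bochner_Integration.integral_cong) (auto simp: GV_def)
      also have "\<dots> = (\<integral>x. GV x * ?b x \<partial>lebesgue_on B)"
        by (rule b[symmetric]) (auto simp: GV_def)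
      also have "- (\<integral>x. GU x * ?a x \<partial>lebesgue_on B) + - (\<integral>x. GV x * ?b x \<partial>lebesgue_on B)
          = - (\<integral>x. GU x * ?a x + GV x * ?b x \<partial>lebesgue_on B)"
        by (subst Bochner_Integration.integral_add[OF int[OF GU \<phi>(1)] int[OF GV \<phi>(2)]]) simp
      also have "(\<integral>x. GU x * ?a x + GV x * ?b x \<partial>lebesgue_on B) = (\<integral>x. g x * \<phi> x \<partial>lebesgue_on B)"
        by (simp add: g_def algebra_simps)
      finally show "(\<integral>x. u x * partial i \<phi> x \<partial>lebesgue_on B) = - (\<integral>x. g x * \<phi> x \<partial>lebesgue_on B)" .
    qed
    ultimately show ?thesis by blast
  qed
  then show ?thesis using u(1) by (simp add: H1_def)
qed

text \<open>The test function is split as for weak derivatives. The coefficient \<open>n\<close> is arbitrary on \<open>U\<close>, so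
  the contribution of \<open>\<theta> \<phi>\<close> may fail to be integrable; the contribution of \<open>(1 - \<theta>) \<phi>\<close> is
  integrable because \<open>n = 1\<close> on \<open>V\<close>.\<close>

lemma helmholtz_glue:
  assumes U: "helmholtz k n (U \<inter> B) u" and V: "helmholtz k n (V \<inter> B) u"
    and n: "\<And>x. x \<in> V \<Longrightarrow> n x = 1" and L2: "u \<in> L2 (lebesgue_on (V \<inter> B))"
  shows "helmholtz k n B u"
  unfolding helmholtz_def
proof
  fix \<phi> assume "\<phi> \<in> test_functions B"
  note \<phi> = split_test_function[OF this]
  let ?I = "\<lambda>\<phi> x. u x * (laplacian \<phi> x + of_real (k\<^sup>2 * (n x)\<^sup>2) * \<phi> x)"
  let ?a = "\<lambda>x. \<theta> x * \<phi> x" and ?b = "\<lambda>x. (1 - \<theta> x) * \<phi> x"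
  have sum: "?I \<phi> x = ?I ?a x + ?I ?b x" for x
  proof -
    have "laplacian \<phi> x = laplacian (\<lambda>x. ?a x + ?b x) x"
      by (rule arg_cong[OF \<phi>(3), of "\<lambda>f. laplacian f x"])
    then have "laplacian \<phi> x = laplacian ?a x + laplacian ?b x"
      by (simp only: laplacian_add[OF \<phi>(1,2)])
    then show ?thesis by (simp add: algebra_simps)
  qed
  have "integral\<^sup>L (lebesgue_on B) (?I ?a) = integral\<^sup>L (lebesgue_on (U \<inter> B)) (?I ?a)"
    by (rule integral_lebesgue_on_subset[OF _ lebesgue_sets(1,3)])
       (use test_functionsD(4)[OF \<phi>(1)] test_functionsD(4)[OF test_functions_laplacian[OF \<phi>(1)]] in simp_all)
  also have "\<dots> = 0" using U \<phi>(1) unfolding helmholtz_def by blast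
  finally have a: "integral\<^sup>L (lebesgue_on B) (?I ?a) = 0" .
  have "integral\<^sup>L (lebesgue_on B) (?I ?b) = integral\<^sup>L (lebesgue_on (V \<inter> B)) (?I ?b)"
    by (rule integral_lebesgue_on_subset[OF _ lebesgue_sets(2,3)])
       (use test_functionsD(4)[OF \<phi>(2)] test_functionsD(4)[OF test_functions_laplacian[OF \<phi>(2)]] in simp_all)
  also have "\<dots> = 0" using V \<phi>(2) unfolding helmholtz_def by blast
  finally have b: "integral\<^sup>L (lebesgue_on B) (?I ?b) = 0" .
  have "integrable (lebesgue_on B)
     (\<lambda>x. (if x \<in> V \<inter> B then u x else 0) * (laplacian ?b x + of_real (k\<^sup>2 * 1\<^sup>2) * ?b x))"
    by (rule L2_test_function_integrable[OF _ helmholtz_test_function[OF \<phi>(2)] lebesgue_sets(3)])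
       (rule L2_zero_extension[OF L2 lebesgue_sets(2,3)], simp)
  also have "(\<lambda>x. (if x \<in> V \<inter> B then u x else 0) * (laplacian ?b x + of_real (k\<^sup>2 * 1\<^sup>2) * ?b x)) = ?I ?b"
  proof
    fix x
    show "(if x \<in> V \<inter> B then u x else 0) * (laplacian ?b x + of_real (k\<^sup>2 * 1\<^sup>2) * ?b x) = ?I ?b x"
    proof (cases "x \<in> V \<inter> B")
      case False
      note zero = test_functionsD(4)[OF \<phi>(2) False] test_functionsD(4)[OF test_functions_laplacian[OF \<phi>(2)] False]
      show ?thesis unfolding zero by simp
    qed (simp add: n)
  qed
  finally have int_b: "integrable (lebesgue_on B) (?I ?b)" .
  show "integral\<^sup>L (lebesgue_on B) (?I \<phi>) = 0"
  proof (cases "integrable (lebesgue_on B) (?I ?a)")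
    case True
    then have "integral\<^sup>L (lebesgue_on B) (\<lambda>x. ?I ?a x + ?I ?b x) = 0 + 0"
      by (simp only: Bochner_Integration.integral_add int_b a b)
    then show ?thesis by (simp only: sum add_0)
  next
    case False
    \<comment> \<open>the whole integrand is then not integrable either, and its integral is \<open>0\<close> by convention\<close>
    have "\<not> integrable (lebesgue_on B) (?I \<phi>)"
    proof
      assume "integrable (lebesgue_on B) (?I \<phi>)"
      then have "integrable (lebesgue_on B) (\<lambda>x. ?I \<phi> x - ?I ?b x)"
        using int_b by (rule Bochner_Integration.integrable_diff)
      moreover have "?I \<phi> x - ?I ?b x = ?I ?a x" for x using sum[of x] by (simp only: add_diff_cancel_right')
      ultimately show False using False by (simp only:)
    qed
    then show ?thesis by (rule not_integrable_integral_eq)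
  qed
qed

end

lemma helmholtz_UNIV:
  assumes "\<And>R. helmholtz k n (ball 0 R) u"
  shows "helmholtz k n UNIV u"
  unfolding helmholtz_def
proof
  fix \<phi> :: "real ^ 'a \<Rightarrow> complex" assume \<phi>: "\<phi> \<in> test_functions UNIV"
  then obtain R where "closure {x. \<phi> x \<noteq> 0} \<subseteq> ball 0 R"
    unfolding test_functions_def by (metis (mono_tags, lifting) bounded_subset_ballD compact_imp_bounded mem_Collect_eq)
  then have \<phi>: "\<phi> \<in> test_functions (ball 0 R)" using \<phi> by (simp add: test_functions_def)
  let ?I = "\<lambda>x. u x * (laplacian \<phi> x + of_real (k\<^sup>2 * (n x)\<^sup>2) * \<phi> x)"
  have "integral\<^sup>L (lebesgue_on UNIV) ?I = integral\<^sup>L (lebesgue_on (ball 0 R)) ?I"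
    by (rule integral_lebesgue_on_subset)
       (use test_functionsD(4)[OF \<phi>] test_functionsD(4)[OF test_functions_laplacian[OF \<phi>]] in simp_all)
  then show "integral\<^sup>L (lebesgue_on UNIV) ?I = 0"
    using assms \<phi> by (simp add: helmholtz_def)
qed

lemma radiating_cong:
  assumes "radiating k z" "\<And>x. R\<^sub>0 < norm x \<Longrightarrow> u x = z x"
  shows "radiating k u"
proof -
  obtain R v where v: "smooth_on {x. R < norm x} v" "AE x in lebesgue_on {x. R < norm x}. z x = v x"
      "(\<lambda>x. radial_deriv v x - \<i> * of_real k * v x)
         \<in> o[at_infinity](\<lambda>x. of_real (norm x powr (- (real CARD('a) - 1) / 2)))"
    using assms(1) unfolding radiating_def by blast
  have sets: "{x :: real ^ 'a. r < norm x} \<in> sets lebesgue" for r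
    by (intro open_sets_lebesgue open_Collect_less continuous_intros)
  have "smooth_on {x. max R R\<^sub>0 < norm x} v"
    using v(1) by (simp add: smooth_on_def)
  moreover have "AE x in lebesgue_on {x. max R R\<^sub>0 < norm x}. u x = v x"
    using v(2) assms(2) sets by (auto simp: AE_restrict_space_iff elim!: eventually_mono)
  ultimately show ?thesis using v(3) unfolding radiating_def by blast
qed

section \<open>The interface system\<close>

theorem mainTheorem1:
  fixes k :: real
    and n :: "real ^ 'm \<Rightarrow> real"
    and \<Omega>\<^sub>0 \<Omega>\<^sub>1 \<Omega>\<^sub>2 \<Omega>\<^sub>1\<^sub>c \<Omega>\<^sub>1\<^sub>2 \<Gamma> \<Sigma> :: "(real ^ 'm) set"
    and uinc f\<^sub>\<Sigma> f\<^sub>\<Gamma> K\<^sub>\<Sigma>\<^sub>\<Gamma>_f\<^sub>\<Gamma> K\<^sub>\<Gamma>\<^sub>\<Sigma>_f\<^sub>\<Sigma> tr\<^sub>\<Sigma>_uinc tr\<^sub>\<Gamma>_uinc :: "real ^ 'm \<Rightarrow> complex"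
  assumes dim: "CARD('m) \<in> {2, 3}"
    and k_pos: "k > 0"
    and \<Omega>\<^sub>0: "domain \<Omega>\<^sub>0" "bounded \<Omega>\<^sub>0"
    and n: "piecewise_smooth n" "closure {x. 1 - n x \<noteq> 0} \<subseteq> closure \<Omega>\<^sub>0"
    and \<Omega>\<^sub>1: "bounded_lipschitz_domain \<Omega>\<^sub>1" "smooth_boundary \<Omega>\<^sub>1" "connected (- closure \<Omega>\<^sub>1)"
    and \<Omega>\<^sub>2: "bounded_lipschitz_domain \<Omega>\<^sub>2" "polyhedral_surface (frontier \<Omega>\<^sub>2)"
            "connected (- closure \<Omega>\<^sub>2)"
    and nested: "closure \<Omega>\<^sub>0 \<subseteq> \<Omega>\<^sub>1" "closure \<Omega>\<^sub>1 \<subseteq> \<Omega>\<^sub>2"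
    and \<Gamma>_eq: "\<Gamma> = frontier \<Omega>\<^sub>1"
    and \<Sigma>_eq: "\<Sigma> = frontier \<Omega>\<^sub>2"
    and \<Omega>\<^sub>1\<^sub>c_eq: "\<Omega>\<^sub>1\<^sub>c = - closure \<Omega>\<^sub>1"
    and \<Omega>\<^sub>1\<^sub>2_eq: "\<Omega>\<^sub>1\<^sub>2 = \<Omega>\<^sub>1\<^sub>c \<inter> \<Omega>\<^sub>2"
    and full_space_wellposed:
      "\<And>ui. incident_wave k ui \<Longrightarrow> \<exists>u. unique_solution lebesgue (full_space_solution k n ui) u"
    and interior_wellposed:
      "\<And>f. f \<in> H_half \<Sigma> \<Longrightarrow> \<exists>w. unique_solution (lebesgue_on \<Omega>\<^sub>2) (interior_solution k n \<Omega>\<^sub>2 f) w"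
    and exterior_wellposed:
      "\<And>f. f \<in> H_half \<Gamma> \<Longrightarrow> \<exists>w. unique_solution (lebesgue_on \<Omega>\<^sub>1\<^sub>c) (exterior_solution k \<Omega>\<^sub>1 f) w"
    and annulus_uniqueness:
      "\<And>v. v \<in> H1 \<Omega>\<^sub>1\<^sub>2 \<Longrightarrow> helmholtz k (\<lambda>_. 1) \<Omega>\<^sub>1\<^sub>2 v \<Longrightarrow>
            has_trace \<Omega>\<^sub>1\<^sub>2 \<Gamma> v (\<lambda>_. 0) \<Longrightarrow> has_trace \<Omega>\<^sub>1\<^sub>2 \<Sigma> v (\<lambda>_. 0) \<Longrightarrow>
            AE x in lebesgue_on \<Omega>\<^sub>1\<^sub>2. v x = 0"
    and uinc: "incident_wave k uinc"
    and f: "f\<^sub>\<Sigma> \<in> H_half \<Sigma>" "f\<^sub>\<Gamma> \<in> H_half \<Gamma>"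
    and K\<^sub>\<Sigma>\<^sub>\<Gamma>: "K_ext_trace k \<Omega>\<^sub>1 \<Sigma> f\<^sub>\<Gamma> K\<^sub>\<Sigma>\<^sub>\<Gamma>_f\<^sub>\<Gamma>"
    and K\<^sub>\<Gamma>\<^sub>\<Sigma>: "K_int_trace k n \<Omega>\<^sub>2 \<Gamma> f\<^sub>\<Sigma> K\<^sub>\<Gamma>\<^sub>\<Sigma>_f\<^sub>\<Sigma>"
    and tr_uinc: "has_trace UNIV \<Sigma> uinc tr\<^sub>\<Sigma>_uinc" "has_trace UNIV \<Gamma> uinc tr\<^sub>\<Gamma>_uinc"
    and interface_system:
      "AE x in surface_measure \<Sigma>. f\<^sub>\<Sigma> x - K\<^sub>\<Sigma>\<^sub>\<Gamma>_f\<^sub>\<Gamma> x = tr\<^sub>\<Sigma>_uinc x"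
      "AE x in surface_measure \<Gamma>. - K\<^sub>\<Gamma>\<^sub>\<Sigma>_f\<^sub>\<Sigma> x + f\<^sub>\<Gamma> x = - tr\<^sub>\<Gamma>_uinc x"
  shows "(AE x in lebesgue_on \<Omega>\<^sub>1\<^sub>2. K_int k n \<Omega>\<^sub>2 f\<^sub>\<Sigma> x = uinc x + K_ext k \<Omega>\<^sub>1 f\<^sub>\<Gamma> x)
    \<and> (let u = (\<lambda>x. if x \<in> \<Omega>\<^sub>2 then K_int k n \<Omega>\<^sub>2 f\<^sub>\<Sigma> x else K_ext k \<Omega>\<^sub>1 f\<^sub>\<Gamma> x + uinc x)
       in (AE x in lebesgue_on \<Omega>\<^sub>2. u x = K_int k n \<Omega>\<^sub>2 f\<^sub>\<Sigma> x)
        \<and> (AE x in lebesgue_on \<Omega>\<^sub>1\<^sub>c. u x = K_ext k \<Omega>\<^sub>1 f\<^sub>\<Gamma> x + uinc x)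
        \<and> unique_solution lebesgue (full_space_solution k n uinc) u)"
proof -
  define w z where "w = K_int k n \<Omega>\<^sub>2 f\<^sub>\<Sigma>" and "z = K_ext k \<Omega>\<^sub>1 f\<^sub>\<Gamma>"
  define u where "u x = (if x \<in> \<Omega>\<^sub>2 then w x else z x + uinc x)" for x
  have "\<exists>w. interior_solution k n \<Omega>\<^sub>2 f\<^sub>\<Sigma> w" "\<exists>z. exterior_solution k \<Omega>\<^sub>1 f\<^sub>\<Gamma> z"
    using interior_wellposed[OF f(1)] exterior_wellposed[OF f(2)] by (auto simp: unique_solution_def)
  then have "interior_solution k n \<Omega>\<^sub>2 f\<^sub>\<Sigma> w" "exterior_solution k \<Omega>\<^sub>1 f\<^sub>\<Gamma> z"
    unfolding w_def z_def K_int_def K_ext_def by (simp_all add: some_eq_ex)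
  then have w: "w \<in> H1 \<Omega>\<^sub>2" "helmholtz k n \<Omega>\<^sub>2 w" "has_trace \<Omega>\<^sub>2 \<Sigma> w f\<^sub>\<Sigma>"
    and z: "z \<in> H1_loc \<Omega>\<^sub>1\<^sub>c" "helmholtz k (\<lambda>_. 1) \<Omega>\<^sub>1\<^sub>c z" "has_trace \<Omega>\<^sub>1\<^sub>c \<Gamma> z f\<^sub>\<Gamma>" "radiating k z"
    by (auto simp: interior_solution_def exterior_solution_def \<Sigma>_eq \<Gamma>_eq \<Omega>\<^sub>1\<^sub>c_eq)
  have w_\<Gamma>: "has_trace \<Omega>\<^sub>2 \<Gamma> w K\<^sub>\<Gamma>\<^sub>\<Sigma>_f\<^sub>\<Sigma>" and z_\<Sigma>: "has_trace \<Omega>\<^sub>1\<^sub>c \<Sigma> z K\<^sub>\<Sigma>\<^sub>\<Gamma>_f\<^sub>\<Gamma>"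
    using K\<^sub>\<Gamma>\<^sub>\<Sigma> K\<^sub>\<Sigma>\<^sub>\<Gamma> by (simp_all add: K_int_trace_def K_ext_trace_def w_def z_def \<Omega>\<^sub>1\<^sub>c_eq)
  have bdd: "bounded \<Omega>\<^sub>1" "bounded \<Omega>\<^sub>2" and "open": "open \<Omega>\<^sub>2" "open \<Omega>\<^sub>1\<^sub>c" "open \<Omega>\<^sub>1\<^sub>2"
    using \<Omega>\<^sub>1(1) \<Omega>\<^sub>2(1) by (auto simp: bounded_lipschitz_domain_def domain_def \<Omega>\<^sub>1\<^sub>c_eq \<Omega>\<^sub>1\<^sub>2_eq)
  note leb = open_sets_lebesgue
  have sub: "\<Omega>\<^sub>1\<^sub>2 \<subseteq> \<Omega>\<^sub>1\<^sub>c" "\<Omega>\<^sub>1\<^sub>2 \<subseteq> \<Omega>\<^sub>2" by (auto simp: \<Omega>\<^sub>1\<^sub>2_eq)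
  have n1: "n x = 1" if "x \<in> \<Omega>\<^sub>1\<^sub>c" for x
  proof -
    have "x \<notin> closure {x. 1 - n x \<noteq> 0}"
      using that n(2) nested(1) closure_subset[of \<Omega>\<^sub>1] by (auto simp: \<Omega>\<^sub>1\<^sub>c_eq)
    then show ?thesis using closure_subset[of "{x. 1 - n x \<noteq> 0}"] by auto
  qed
  have uinc_H1: "uinc \<in> H1 S" if S: "open S" "bounded S" for S
  proof -
    obtain R where "S \<subseteq> ball 0 R" using bounded_subset_ballD[OF S(2)] by blast
    then show ?thesis
      using H1_subset[OF has_trace_H1[OF tr_uinc(1), of R]] S(1) by (simp add: leb)
  qed
  have z_H1: "z \<in> H1 S" if S: "open S" "bounded S" "S \<subseteq> \<Omega>\<^sub>1\<^sub>c" for S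
  proof -
    obtain R where "S \<subseteq> ball 0 R" using bounded_subset_ballD[OF S(2)] by blast
    moreover have "z \<in> H1 (\<Omega>\<^sub>1\<^sub>c \<inter> ball 0 R)" using z(1) by (simp add: H1_loc_def)
    ultimately show ?thesis
      using S "open" by (elim H1_subset) (auto intro!: leb)
  qed

  \<comment> \<open>The difference of the two fields has zero trace on each interface by the corresponding interface
    equation. The coefficient \<open>-1\<close> keeps it in the form of iterated linear combinations.\<close>
  have *: "AE x in lebesgue_on \<Omega>\<^sub>1\<^sub>2. (w x + (-1) * z x) + (-1) * uinc x = 0"
  proof (rule annulus_uniqueness)
    have bdd12: "bounded \<Omega>\<^sub>1\<^sub>2" using bdd(2) sub(2) by (rule bounded_subset)
    have H1: "w \<in> H1 \<Omega>\<^sub>1\<^sub>2" "z \<in> H1 \<Omega>\<^sub>1\<^sub>2" "uinc \<in> H1 \<Omega>\<^sub>1\<^sub>2"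
      using H1_subset[OF w(1) sub(2)] z_H1 uinc_H1 bdd12 "open" sub(1) by (simp_all add: leb)
    then show "(\<lambda>x. (w x + (-1) * z x) + (-1) * uinc x) \<in> H1 \<Omega>\<^sub>1\<^sub>2"
      using "open"(3) by (intro H1_lincomb leb)
    have "helmholtz k n \<Omega>\<^sub>1\<^sub>2 w" by (rule helmholtz_subset[OF w(2) sub(2)]) (intro leb "open")+
    then have "helmholtz k (\<lambda>_. 1) \<Omega>\<^sub>1\<^sub>2 w"
      by (rule helmholtz_cong) (use n1 sub "open" in \<open>auto intro: leb\<close>)
    moreover have "helmholtz k (\<lambda>_. 1) \<Omega>\<^sub>1\<^sub>2 z"
      by (rule helmholtz_subset[OF z(2) sub(1)]) (intro leb "open")+
    moreover have "helmholtz k (\<lambda>_. 1) \<Omega>\<^sub>1\<^sub>2 uinc"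
      using incident_wave_helmholtz[OF uinc leb[OF "open"(3)]] .
    ultimately show "helmholtz k (\<lambda>_. 1) \<Omega>\<^sub>1\<^sub>2 (\<lambda>x. (w x + (-1) * z x) + (-1) * uinc x)"
      using H1[THEN H1D] leb[OF "open"(3)] by (intro helmholtz_lincomb L2_lincomb)
    \<comment> \<open>On each interface its own approximating sequences are combined: one of the two fields has the
      interface as the boundary of its domain, the other one has it in the interior.\<close>
    have tr: "has_trace \<Omega>\<^sub>1\<^sub>2 S (\<lambda>x. (w x + (-1) * z x) + (-1) * uinc x) (\<lambda>_. 0)"
      if "has_trace \<Omega>\<^sub>2 S w a" "has_trace \<Omega>\<^sub>1\<^sub>c S z b" "has_trace UNIV S uinc c"
        "AE x in surface_measure S. (a x + (-1) * b x) + (-1) * c x = 0" for S a b c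
    proof (rule has_trace_AE_cong[OF _ that(4)])
      show "has_trace \<Omega>\<^sub>1\<^sub>2 S (\<lambda>x. (w x + (-1) * z x) + (-1) * uinc x) (\<lambda>x. (a x + (-1) * b x) + (-1) * c x)"
        using "open" sub that(1-3) by (intro has_trace_lincomb) (auto intro: has_trace_subset)
    qed (simp add: L2_def)
    show "has_trace \<Omega>\<^sub>1\<^sub>2 \<Gamma> (\<lambda>x. (w x + (-1) * z x) + (-1) * uinc x) (\<lambda>_. 0)"
      by (rule tr[OF w_\<Gamma> z(3) tr_uinc(2)])
         (use interface_system(2) in \<open>auto elim!: eventually_mono simp: algebra_simps\<close>)
    show "has_trace \<Omega>\<^sub>1\<^sub>2 \<Sigma> (\<lambda>x. (w x + (-1) * z x) + (-1) * uinc x) (\<lambda>_. 0)"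
      by (rule tr[OF w(3) z_\<Sigma> tr_uinc(1)])
         (use interface_system(1) in \<open>auto elim!: eventually_mono simp: algebra_simps\<close>)
  qed
  then have agree: "AE x in lebesgue_on \<Omega>\<^sub>1\<^sub>2. w x = uinc x + z x"
    by (auto elim!: eventually_mono simp: algebra_simps)
  have u_ext: "AE x in lebesgue_on \<Omega>\<^sub>1\<^sub>c. u x = z x + uinc x"
    using agree "open"
    by (auto simp: AE_restrict_space_iff leb u_def \<Omega>\<^sub>1\<^sub>2_eq elim!: eventually_mono)

  \<comment> \<open>Both descriptions of \<open>u\<close> hold almost everywhere on open sets that cover the space, and they are glued
    by a cutoff that is \<open>1\<close> near \<open>closure \<Omega>\<^sub>1\<close> and supported in \<open>\<Omega>\<^sub>2\<close>.\<close>
  have cover: "\<Omega>\<^sub>2 \<union> \<Omega>\<^sub>1\<^sub>c = UNIV" using nested(2) by (auto simp: \<Omega>\<^sub>1\<^sub>c_eq)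
  have "compact (closure \<Omega>\<^sub>1)" using bdd(1) by (simp add: compact_closure)
  then obtain \<theta> :: "real ^ 'm \<Rightarrow> complex" and N where \<theta>: "smooth_on UNIV \<theta>"
      "closure {x. \<theta> x \<noteq> 0} \<subseteq> \<Omega>\<^sub>2" "\<And>x. cmod (\<theta> x) \<le> 1"
    and N: "open N" "closure \<Omega>\<^sub>1 \<subseteq> N" "\<And>x. x \<in> N \<Longrightarrow> \<theta> x = 1"
    using smooth_cutoff[OF _ "open"(1) nested(2)] by metis
  have "closure {x. 1 - \<theta> x \<noteq> 0} \<subseteq> - N"
    by (rule closure_minimal) (use N in auto)
  then have supp: "closure {x. 1 - \<theta> x \<noteq> 0} \<subseteq> \<Omega>\<^sub>1\<^sub>c" using N(2) by (auto simp: \<Omega>\<^sub>1\<^sub>c_eq)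

  have ball_solution: "u \<in> H1 (ball c R) \<and> helmholtz k n (ball c R) u" for c R
  proof -
    let ?B = "ball c R"
    interpret cutoff \<Omega>\<^sub>2 \<Omega>\<^sub>1\<^sub>c ?B \<theta>
      by unfold_locales (use "open" \<theta> supp in auto)
    let ?e = "\<lambda>x. z x + 1 * uinc x"
    have z: "z \<in> H1 (\<Omega>\<^sub>1\<^sub>c \<inter> ?B)" and "uinc \<in> H1 (\<Omega>\<^sub>1\<^sub>c \<inter> ?B)"
      using "open" by (auto intro!: z_H1 uinc_H1)
    then have e: "?e \<in> H1 (\<Omega>\<^sub>1\<^sub>c \<inter> ?B)" using lebesgue_sets by (intro H1_lincomb)
    have w': "w \<in> H1 (\<Omega>\<^sub>2 \<inter> ?B)"
      by (rule H1_subset[OF w(1)]) (use lebesgue_sets "open" in \<open>auto intro: leb\<close>)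
    have AE: "AE x in lebesgue_on (\<Omega>\<^sub>1\<^sub>c \<inter> ?B). u x = ?e x"
      using u_ext "open" by (auto simp: AE_restrict_space_iff leb elim!: eventually_mono)
    have T: "?B - \<Omega>\<^sub>2 \<in> sets lebesgue" using "open" by (intro sets.Diff leb) auto
    have "u \<in> L2 (lebesgue_on (\<Omega>\<^sub>2 \<inter> ?B \<union> (?B - \<Omega>\<^sub>2)))"
    proof (rule L2_Un_disjoint)
      show "u \<in> L2 (lebesgue_on (\<Omega>\<^sub>2 \<inter> ?B))"
        by (rule L2_cong[OF H1D[OF w']]) (auto simp: u_def)
      have "?e \<in> L2 (lebesgue_on (?B - \<Omega>\<^sub>2))"
        by (rule L2_subset[OF H1D[OF e]]) (use cover lebesgue_sets T in auto)
      then show "u \<in> L2 (lebesgue_on (?B - \<Omega>\<^sub>2))"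
        by (rule L2_cong) (auto simp: u_def)
    qed (use lebesgue_sets T in auto)
    moreover have "\<Omega>\<^sub>2 \<inter> ?B \<union> (?B - \<Omega>\<^sub>2) = ?B" by auto
    ultimately have u: "u \<in> L2 (lebesgue_on ?B)" by simp
    have u_V: "u \<in> L2 (lebesgue_on (\<Omega>\<^sub>1\<^sub>c \<inter> ?B))"
      by (rule L2_subset[OF u]) (use lebesgue_sets in auto)
    have u_U: "u \<in> L2 (lebesgue_on (\<Omega>\<^sub>2 \<inter> ?B))"
      by (rule L2_subset[OF u]) (use lebesgue_sets in auto)
    have "u \<in> H1 ?B"
    proof (rule H1_glue[OF u])
      show "u \<in> H1 (\<Omega>\<^sub>2 \<inter> ?B)"
        by (rule H1_AE_cong[OF w' _ u_U]) (use lebesgue_sets in \<open>auto simp: u_def intro!: AE_I2\<close>)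
      show "u \<in> H1 (\<Omega>\<^sub>1\<^sub>c \<inter> ?B)"
        by (rule H1_AE_cong[OF e AE u_V]) (use lebesgue_sets in auto)
    qed
    moreover have "helmholtz k n ?B u"
    proof (rule helmholtz_glue[OF _ _ n1 u_V])
      have "helmholtz k n (\<Omega>\<^sub>2 \<inter> ?B) w"
        by (rule helmholtz_subset[OF w(2)]) (use lebesgue_sets "open" in \<open>auto intro: leb\<close>)
      then show "helmholtz k n (\<Omega>\<^sub>2 \<inter> ?B) u"
        by (rule helmholtz_cong) (use lebesgue_sets in \<open>auto simp: u_def\<close>)
      have "helmholtz k (\<lambda>_. 1) (\<Omega>\<^sub>1\<^sub>c \<inter> ?B) z"
        by (rule helmholtz_subset[OF \<open>helmholtz k (\<lambda>_. 1) \<Omega>\<^sub>1\<^sub>c z\<close>])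
           (use lebesgue_sets "open" in \<open>auto intro: leb\<close>)
      then have "helmholtz k (\<lambda>_. 1) (\<Omega>\<^sub>1\<^sub>c \<inter> ?B) ?e"
        using \<open>z \<in> H1 _\<close>[THEN H1D] \<open>uinc \<in> H1 _\<close>[THEN H1D] lebesgue_sets(2)
        by (intro helmholtz_lincomb incident_wave_helmholtz[OF uinc])
      then have "helmholtz k (\<lambda>_. 1) (\<Omega>\<^sub>1\<^sub>c \<inter> ?B) u"
        by (rule helmholtz_AE_cong[OF _ AE]) (use H1D[OF e] u_V lebesgue_sets in \<open>auto simp: L2_def\<close>)
      then show "helmholtz k n (\<Omega>\<^sub>1\<^sub>c \<inter> ?B) u"
        by (rule helmholtz_cong) (use n1 lebesgue_sets in auto)
    qed
    ultimately show ?thesis by blast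
  qed
  have "full_space_solution k n uinc u"
    unfolding full_space_solution_def
  proof (intro conjI)
    show "u \<in> H1_loc UNIV" using ball_solution by (simp add: H1_loc_def)
    show "helmholtz k n UNIV u" using ball_solution by (intro helmholtz_UNIV) blast
    obtain R where R: "\<Omega>\<^sub>2 \<subseteq> ball 0 R" using bounded_subset_ballD[OF bdd(2)] by blast
    show "radiating k (\<lambda>x. u x - uinc x)"
      by (rule radiating_cong[OF z(4), of R]) (use R in \<open>force simp: u_def\<close>)
  qed
  moreover obtain u' where "unique_solution lebesgue (full_space_solution k n uinc) u'"
    using full_space_wellposed[OF uinc] by blast
  ultimately have unique: "unique_solution lebesgue (full_space_solution k n uinc) u"
    unfolding unique_solution_def
  proof (intro conjI allI impI)
    fix v assume u: "full_space_solution k n uinc u" and v: "full_space_solution k n uinc v"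
      and u': "full_space_solution k n uinc u' \<and>
        (\<forall>v. full_space_solution k n uinc v \<longrightarrow> (AE x in lebesgue. v x = u' x))"
    have "AE x in lebesgue. v x = u' x" "AE x in lebesgue. u x = u' x" using u v u' by blast+
    then show "AE x in lebesgue. v x = u x" by eventually_elim simp
  qed
  have "AE x in lebesgue_on \<Omega>\<^sub>2. u x = w x"
    by (rule AE_I2) (simp add: u_def)
  with agree u_ext unique show ?thesis
    unfolding Let_def u_def[abs_def] w_def z_def by blast
qed

end
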